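(* Under the standing setup below, $A^{P(\sigma)}\equiv 1\pmod{\pi^{2(p-1)}}$, where $A^{P(\sigma)}=\prod_{i=0}^{p-2}\sigma^i(A)^{v^{-i}}$.
   Context: Let $p$ be an odd prime, $\zeta_p$ a primitive $p$-th root of unity, $K_p=\mathbb Q(\zeta_p)$ with ring of integers $\mathbb Z[\zeta_p]$, $K_p^+$ its maximal totally real subfield, $\lambda=\zeta_p-1$, $\pi=\lambda\mathbb Z[\zeta_p]$; for $x,y\in K_p$, $x\equiv y\pmod{\pi^k}$ means the $\pi$-adic valuation of $x-y$ is at least $k$, and $\pi^k\,\|\,x$ means $x\in\pi^k$, $x\notin\pi^{k+1}$. Fix a primitive root $v$ modulo $p$; for $n\in\mathbb Z$, $v^n$ denotes the integer in $\{1,\dots,p-1\}$ congruent to $v^n$ modulo $p$ (for $n<0$ using the inverse of $v$ mod $p$). Let $\sigma\in G_p=\mathrm{Gal}(K_p/\mathbb Q)$ be $\zeta_p\mapsto\zeta_p^v$ and $P(\sigma)=\sum_{i=0}^{p-2}v^{-i}\sigma^i\in\mathbb Z[G_p]$. Standing setup: assume $p$ is irregular and $p$ does not divide the class number of $K_p^+$. Let $C_p$ be the $p$-Sylow subgroup of the ideal class group of $K_p$, $m$ an integer with $1\le m\le\frac{p-3}{2}$, $\mu=v^{2m+1}$, and $\Gamma\subset C_p$ a subgroup of order $p$ annihilated by $\sigma-\mu$. Let $\mathbf q$ be a non-principal prime ideal of $\mathbb Z[\zeta_p]$ of inertial degree $1$ (so $N\mathbf q=q\equiv1\pmod p$) whose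 class lies in $\Gamma$, and let $A\in\mathbb Z[\zeta_p]$ with $A\mathbb Z[\zeta_p]=\mathbf q^p$, $\sigma(A)=A^{\mu}\alpha^p$ for some $\alpha\in K_p$, $\pi^{2m+1}\,\|\,A-1$, and $A\overline A=D^p$ for some $D$ in the ring of integers of $K_p^+$. *)

theory Defs
  imports Complex_Main "HOL-Number_Theory.Number_Theory" "HOL-Algebra.Group"
begin

definition zeta :: "nat \<Rightarrow> complex" where
  "zeta p = cis (2 * pi / real p)"

definition lam :: "nat \<Rightarrow> complex" where
  "lam p = zeta p - 1"

definition Zz :: "nat \<Rightarrow> complex set" where
  "Zz p = {x. \<exists>a :: nat \<Rightarrow> int. x = (\<Sum>i<p. of_int (a i) * zeta p ^ i)}"

definition Kp :: "nat \<Rightarrow> complex set" where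
  "Kp p = {x. \<exists>a :: nat \<Rightarrow> rat. x = (\<Sum>i<p. of_rat (a i) * zeta p ^ i)}"

text \<open>Ring of integers of the maximal real subfield K_p^+ (= Z[zeta_p] intersected with the reals)\<close>
definition Zplus :: "nat \<Rightarrow> complex set" where
  "Zplus p = {x \<in> Zz p. x \<in> \<real>}"

text \<open>The Galois automorphism sigma: zeta_p to zeta_p^v (on elements of K_p)\<close>
definition sig :: "nat \<Rightarrow> nat \<Rightarrow> complex \<Rightarrow> complex" where
  "sig p v x = (SOME y. \<exists>a :: nat \<Rightarrow> rat.
      x = (\<Sum>i<p. of_rat (a i) * zeta p ^ i) \<and> y = (\<Sum>i<p. of_rat (a i) * zeta p ^ (v * i)))"

text \<open>v^n for n \<ge> 0 and v^(-n), as representatives in {1..p-1}\<close>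
definition vpow :: "nat \<Rightarrow> nat \<Rightarrow> nat \<Rightarrow> nat" where
  "vpow p v n = (v ^ n) mod p"

definition vinvpow :: "nat \<Rightarrow> nat \<Rightarrow> nat \<Rightarrow> nat" where
  "vinvpow p v n = (v ^ ((p - 2) * n)) mod p"

definition cong_pi :: "nat \<Rightarrow> nat \<Rightarrow> complex \<Rightarrow> complex \<Rightarrow> bool" where
  "cong_pi p k x y \<longleftrightarrow> (\<exists>z \<in> Zz p. x - y = lam p ^ k * z)"

definition exact_pi :: "nat \<Rightarrow> nat \<Rightarrow> complex \<Rightarrow> bool" where
  "exact_pi p k x \<longleftrightarrow> cong_pi p k x 0 \<and> \<not> cong_pi p (Suc k) x 0"

definition Psig :: "nat \<Rightarrow> nat \<Rightarrow> complex \<Rightarrow> complex" where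
  "Psig p v A = (\<Prod>i\<in>{0..p-2}. ((sig p v ^^ i) A) ^ vinvpow p v i)"

definition is_ideal :: "complex set \<Rightarrow> complex set \<Rightarrow> bool" where
  "is_ideal R I \<longleftrightarrow> I \<subseteq> R \<and> 0 \<in> I \<and> (\<forall>x\<in>I. \<forall>y\<in>I. x + y \<in> I)
      \<and> (\<forall>r\<in>R. \<forall>x\<in>I. r * x \<in> I)"

definition nz_ideal :: "complex set \<Rightarrow> complex set \<Rightarrow> bool" where
  "nz_ideal R I \<longleftrightarrow> is_ideal R I \<and> I \<noteq> {0}"

definition principal :: "complex set \<Rightarrow> complex \<Rightarrow> complex set" where
  "principal R a = {a * r | r. r \<in> R}"

definition is_principal :: "complex set \<Rightarrow> complex set \<Rightarrow> bool" where
  "is_principal R I \<longleftrightarrow> (\<exists>a\<in>R. I = principal R a)"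

definition prime_ideal :: "complex set \<Rightarrow> complex set \<Rightarrow> bool" where
  "prime_ideal R I \<longleftrightarrow> is_ideal R I \<and> I \<noteq> R \<and> I \<noteq> {0}
      \<and> (\<forall>x\<in>R. \<forall>y\<in>R. x * y \<in> I \<longrightarrow> x \<in> I \<or> y \<in> I)"

definition ideal_prod :: "complex set \<Rightarrow> complex set \<Rightarrow> complex set \<Rightarrow> complex set" where
  "ideal_prod R I J = \<Inter>{M. is_ideal R M \<and> {x * y | x y. x \<in> I \<and> y \<in> J} \<subseteq> M}"

fun ideal_pow :: "complex set \<Rightarrow> complex set \<Rightarrow> nat \<Rightarrow> complex set" where
  "ideal_pow R I 0 = R"
| "ideal_pow R I (Suc n) = ideal_prod R I (ideal_pow R I n)"

definition ideal_norm :: "complex set \<Rightarrow> complex set \<Rightarrow> nat" where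
  "ideal_norm R I = card ((\<lambda>x. {y \<in> R. x - y \<in> I}) ` R)"

definition ideal_equiv :: "complex set \<Rightarrow> complex set \<Rightarrow> complex set \<Rightarrow> bool" where
  "ideal_equiv R I J \<longleftrightarrow> (\<exists>a\<in>R - {0}. \<exists>b\<in>R - {0}. (\<lambda>x. a * x) ` I = (\<lambda>x. b * x) ` J)"

definition ideal_class :: "complex set \<Rightarrow> complex set \<Rightarrow> complex set set" where
  "ideal_class R I = {J. nz_ideal R J \<and> ideal_equiv R I J}"

definition ideal_classes :: "complex set \<Rightarrow> complex set set set" where
  "ideal_classes R = {ideal_class R I | I. nz_ideal R I}"

definition class_number :: "complex set \<Rightarrow> nat" where
  "class_number R = card (ideal_classes R)"

definition class_group :: "complex set \<Rightarrow> complex set set monoid" where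
  "class_group R = \<lparr> carrier = ideal_classes R,
      mult = (\<lambda>c d. ideal_class R (ideal_prod R (SOME I. I \<in> c) (SOME J. J \<in> d))),
      one = ideal_class R R \<rparr>"

definition sylow_part :: "complex set \<Rightarrow> nat \<Rightarrow> complex set set set" where
  "sylow_part R p = {c \<in> ideal_classes R. \<exists>k. c [^]\<^bsub>class_group R\<^esub> (p ^ k) = \<one>\<^bsub>class_group R\<^esub>}"

definition sig_class :: "nat \<Rightarrow> nat \<Rightarrow> complex set set \<Rightarrow> complex set set" where
  "sig_class p v c = ideal_class (Zz p) (sig p v ` (SOME I. I \<in> c))"

end

theory Submission
  imports Defs "HOL-Computational_Algebra.Polynomial_Factorial"
begin

text \<open>
  Let \<open>l\<close> be the norm of \<open>q\<close>, let \<open>\<chi>\<close> be the inverse of the \<open>p\<close>-th power residue character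
  modulo \<open>q\<close>, and let \<open>G\<close> be the \<open>p\<close>-th power of its Gauss sum. Stickelberger's congruences for the
  Jacobi sums show that \<open>G\<close> is divisible by \<open>\<sigma> q ^ b\<close> for the automorphism \<open>\<sigma>\<close> inverse to
  \<open>\<zeta> \<mapsto> \<zeta> ^ b\<close>, hence \<open>A ^ P(\<sigma>)\<close> divides \<open>G ^ p\<close>. Both have the same absolute
  value: \<open>A * cnj A\<close> being a \<open>p\<close>-th power forces the norm of \<open>A\<close> to be \<open>l ^ p\<close>. So their quotient is a unit
  all of whose conjugates have absolute value 1. Since \<open>A \<equiv> 1\<close> modulo \<open>\<pi>\<^sup>2\<close> and \<open>G \<equiv> -1\<close> modulo
  \<open>p\<close>, this unit is \<open>-1\<close> modulo \<open>\<pi>\<^sup>2\<close>, and therefore equal to \<open>-1\<close>. Finally \<open>G ^ p \<equiv> -1\<close> modulo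
  \<open>p\<^sup>2\<close>, and \<open>p\<^sup>2\<close> generates \<open>\<pi>\<close> to the power \<open>2 * (p - 1)\<close>.
\<close>

section \<open>Eisenstein polynomials\<close>

text \<open>Since \<open>q\<close> is not principal, ideal factorisations of Jacobi sums cannot be
  written as equations between elements. What survives is that \<open>x \<in> q\<close> makes
  \<open>A\<close> divide \<open>x ^ p\<close>; this is why \<open>G ^ p\<close>, and not
  \<open>G\<close>, is compared with the product of conjugates of \<open>A\<close>. Pairwise
  comaximality of these conjugates takes over the role of unique factorisation of ideals. The
  residue field is handled through integers: degree one makes every residue class contain an
  integer, so \<open>\<zeta>\<close> reduces to an integer \<open>r\<close> of order
  \<open>p\<close> modulo \<open>l\<close>, and congruences modulo \<open>q\<close> become
  congruences modulo \<open>l\<close>. The inverse character is dictated by the exponents. With it,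
  for each \<open>b\<close> exactly \<open>b - 1\<close> of the Jacobi sums are sent into
  \<open>q\<close> by \<open>\<zeta> \<mapsto> \<zeta> ^ b\<close>, and the factor \<open>l\<close>
  of \<open>G\<close> supplies one more, giving the exponent \<open>b\<close> of
  \<open>P(\<sigma>)\<close>; the residue character itself would give \<open>p - b\<close>.
  Irreducibility of the cyclotomic polynomial has to come before all this, because
  \<open>sig\<close> is defined by a choice of expansion in powers of
  \<open>\<zeta>\<close>.\<close>

lemma eisenstein_degree:
  fixes a b :: "int poly" and p :: int
  assumes p: "prime p" and div: "\<And>k. k < n \<Longrightarrow> p dvd coeff (a * b) k"
    and b0: "\<not> p dvd coeff b 0" and la: "\<not> p dvd lead_coeff a"
  shows "n \<le> degree a"
proof -
  \<comment> \<open>Modulo \<open>p\<close> the coefficient of the product at this index is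
    \<open>coeff a k * coeff b 0\<close>, because the earlier coefficients of \<open>a\<close>
    vanish there. It is not zero, so the index is at least \<open>n\<close>.\<close>
  define k where "k = (LEAST k. \<not> p dvd coeff a k)"
  have k: "\<not> p dvd coeff a k" unfolding k_def using la by (rule LeastI)
  have less: "p dvd coeff a i" if "i < k" for i
    using not_less_Least[of i "\<lambda>k. \<not> p dvd coeff a k"] that unfolding k_def by auto
  have "coeff (a * b) k = (\<Sum>i\<le>k. coeff a i * coeff b (k - i))" by (simp add: coeff_mult)
  also have "\<dots> = (\<Sum>i<k. coeff a i * coeff b (k - i)) + coeff a k * coeff b 0"
    by (simp add: lessThan_Suc_atMost[symmetric])
  finally have eq: "coeff (a * b) k = (\<Sum>i<k. coeff a i * coeff b (k - i)) + coeff a k * coeff b 0" .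
  have "p dvd (\<Sum>i<k. coeff a i * coeff b (k - i))" by (intro dvd_sum dvd_mult2 less) auto
  moreover have "\<not> p dvd coeff a k * coeff b 0" using k b0 p by (simp add: prime_dvd_mult_iff)
  ultimately have "\<not> p dvd coeff (a * b) k" unfolding eq by (simp add: dvd_add_right_iff)
  then have "n \<le> k" using div not_less by blast
  also have "k \<le> degree a" using k by (metis dvd_0_right le_degree)
  finally show ?thesis .
qed

lemma eisenstein_irreducible:
  fixes f :: "int poly" and p :: int
  assumes p: "prime p" and monic: "lead_coeff f = 1" and deg: "degree f > 0"
    and div: "\<And>k. k < degree f \<Longrightarrow> p dvd coeff f k" and sq: "\<not> p\<^sup>2 dvd coeff f 0"
  shows "irreducible f"
proof (rule irreducibleI)
  show "f \<noteq> 0" using deg by auto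
  show "\<not> f dvd 1" using deg by (auto simp: is_unit_poly_iff)
  fix a b assume ab: "f = a * b"
  have lc: "lead_coeff a * lead_coeff b = 1" using monic ab by (simp add: lead_coeff_mult)
  have unit: "x dvd 1" if "x = c \<or> x = d" "degree x = 0" "f = c * d" for x c d :: "int poly"
  proof -
    have "lead_coeff c * lead_coeff d = 1" using monic that(3) by (simp add: lead_coeff_mult)
    then have "lead_coeff x dvd 1" using that(1) by (metis dvd_triv_left dvd_triv_right)
    then show ?thesis using that(2) by (metis degree_eq_zeroE is_unit_poly_iff lead_coeff_pCons(2) pCons_eq_0_iff lead_coeff_pCons degree_pCons_0 coeff_pCons_0)
  qed
  have nz: "a \<noteq> 0" "b \<noteq> 0" using lc by auto
  have degs: "degree f = degree a + degree b" using nz ab by (simp add: degree_mult_eq)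
  have la: "\<not> p dvd lead_coeff a" "\<not> p dvd lead_coeff b"
    using lc p by (metis dvd_mult2 not_prime_unit dvd_mult)+
  \<comment> \<open>If \<open>p\<close> divided both constant terms, its square would divide that of
    \<open>f\<close>. The factor opposite to a constant term prime to \<open>p\<close> then takes
    the whole degree.\<close>
  have "\<not> (p dvd coeff a 0 \<and> p dvd coeff b 0)"
    using sq unfolding ab power2_eq_square by (auto simp: coeff_mult mult_dvd_mono)
  then consider "\<not> p dvd coeff b 0" | "\<not> p dvd coeff a 0" by blast
  then show "a dvd 1 \<or> b dvd 1"
  proof cases
    case 1
    have "degree f \<le> degree a"
      by (rule eisenstein_degree[OF p _ 1 la(1)]) (use div ab in auto)
    then show ?thesis using unit[of b a b] ab degs by simp
  next
    case 2
    have "degree f \<le> degree b"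
      by (rule eisenstein_degree[OF p _ 2 la(2)]) (use div ab in \<open>auto simp: mult.commute\<close>)
    then show ?thesis using unit[of a a b] ab degs by simp
  qed
qed

section \<open>Values of integer polynomials at complex numbers and least degrees\<close>

definition int_eval :: "int poly \<Rightarrow> complex \<Rightarrow> complex" where
  "int_eval f x = poly (map_poly of_int f) x"

lemma int_eval_pCons: "int_eval (pCons a f) x = of_int a + x * int_eval f x"
  by (simp add: int_eval_def map_poly_pCons)

lemma int_eval_0 [simp]: "int_eval 0 x = 0"
  by (simp add: int_eval_def)

lemma int_eval_add: "int_eval (f + g) x = int_eval f x + int_eval g x"
  by (induction f g rule: poly_induct2) (simp_all add: int_eval_pCons algebra_simps)

lemma int_eval_smult: "int_eval (smult c f) x = of_int c * int_eval f x"
  by (induction f) (simp_all add: int_eval_pCons algebra_simps)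

lemma int_eval_mult: "int_eval (f * g) x = int_eval f x * int_eval g x"
  by (induction f) (simp_all add: int_eval_pCons int_eval_add int_eval_smult algebra_simps)

lemma int_eval_sum: "int_eval (sum f I) x = (\<Sum>i\<in>I. int_eval (f i) x)"
  by (induction I rule: infinite_finite_induct) (simp_all add: int_eval_add)

lemma int_eval_monom: "int_eval (monom c k) x = of_int c * x ^ k"
  by (simp add: int_eval_def map_poly_monom poly_monom)

lemma int_eval_pcompose: "int_eval (pcompose f g) x = int_eval f (int_eval g x)"
  by (induction f) (simp_all add: pcompose_pCons int_eval_add int_eval_mult int_eval_pCons)

text \<open>Pseudo-division shows that a polynomial of least degree divides an integer multiple of the
  irreducible one, which is prime.\<close>
lemma irreducible_min_degree:
  fixes f g :: "int poly"
  assumes irr: "irreducible f" and f0: "int_eval f x = 0" and g0: "int_eval g x = 0"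
    and deg: "degree g < degree f"
  shows "g = 0"
proof (rule ccontr)
  assume "g \<noteq> 0"
  define P where "P = (\<lambda>d. \<exists>m. m \<noteq> 0 \<and> int_eval m x = 0 \<and> degree m = d)"
  have "P (degree g)" using \<open>g \<noteq> 0\<close> g0 by (auto simp: P_def)
  define d where "d = (LEAST d. P d)"
  have "P d" unfolding d_def by (rule LeastI) fact
  have dg: "d \<le> degree g" unfolding d_def by (rule Least_le) fact
  obtain m where m: "m \<noteq> 0" "int_eval m x = 0" "degree m = d"
    using \<open>P d\<close> by (auto simp: P_def)
  obtain q r where qr: "pseudo_divmod f m = (q, r)" by fastforce
  define c where "c = lead_coeff m ^ (Suc (degree f) - degree m)"
  have c: "smult c f = m * q + r" and r: "r = 0 \<or> degree r < degree m"
    using pseudo_divmod[OF m(1) qr] unfolding c_def by blast+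
  have "c \<noteq> 0" using m(1) by (simp add: c_def)
  have "int_eval r x = 0"
    using arg_cong[OF c, of "\<lambda>h. int_eval h x"] m f0 by (simp add: int_eval_add int_eval_mult int_eval_smult)
  then have "r = 0" using r m not_less_Least[of "degree r" P]
    unfolding d_def[symmetric] by (auto simp: P_def)
  then have c': "[:c:] * f = m * q" using c by simp
  \<comment> \<open>Gauss's lemma enters here: integer polynomials form a factorial ring.
    Divisibility of \<open>m\<close> by \<open>f\<close> is excluded by degrees; divisibility of
    \<open>q\<close> lets \<open>f\<close> cancel and leaves \<open>m\<close> a nonzero constant,
    which has no root.\<close>
  have "prime_elem f" using irr by (rule irreducible_imp_prime_elem)
  moreover have "f dvd m * q" unfolding c'[symmetric] by (rule dvd_triv_right)
  ultimately have "f dvd m \<or> f dvd q" by (simp add: prime_elem_dvd_mult_iff)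
  then show False
  proof
    assume "f dvd m"
    then have "degree f \<le> degree m" by (rule dvd_imp_degree_le) (fact m(1))
    then show False using m dg deg by simp
  next
    assume "f dvd q"
    then obtain s where "q = f * s" by auto
    then have "f * [:c:] = f * (m * s)" using c' by (simp add: algebra_simps)
    moreover have "f \<noteq> 0" using irr by auto
    ultimately have cs: "[:c:] = m * s" by (metis mult_cancel_left)
    then have "s \<noteq> 0" using \<open>c \<noteq> 0\<close> by auto
    then have "degree m = 0" using cs m degree_mult_eq[of m s] by (metis add_is_0 degree_pCons_0)
    then obtain k where k: "m = [:k:]" by (rule degree_eq_zeroE)
    then show False using m by (simp add: int_eval_def map_poly_pCons)
  qed
qed

section \<open>Roots of unity and the cyclotomic relation\<close>

lemma zeta_power_eq_1_iff:
  assumes "n > 0"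
  shows "zeta n ^ k = 1 \<longleftrightarrow> n dvd k"
proof
  assume "n dvd k"
  then obtain j where "k = n * j" by auto
  then have "zeta n ^ k = cis (2 * pi * real j)"
    using assms by (simp add: zeta_def DeMoivre mult_ac)
  then show "zeta n ^ k = 1" by (simp add: cis_multiple_2pi)
next
  assume eq: "zeta n ^ k = 1"
  have inj: "inj_on (\<lambda>j. cis (2 * pi * real j / real n)) {..<n}"
    using bij_betw_roots_unity[OF assms] by (simp add: bij_betw_def)
  have zn: "zeta n ^ n = 1"
    using assms by (simp add: zeta_def DeMoivre)
  have "zeta n ^ (n * (k div n) + k mod n) = 1" using eq by simp
  then have "zeta n ^ (k mod n) = 1" unfolding power_add power_mult zn by simp
  then have "cis (2 * pi * real (k mod n) / real n) = cis (2 * pi * real 0 / real n)"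
    by (simp add: zeta_def DeMoivre mult_ac)
  then have "k mod n = 0" using inj_onD[OF inj] assms by auto
  then show "n dvd k" by auto
qed

lemma zeta_power_cong:
  assumes "n > 0" "[a = b] (mod n)"
  shows "zeta n ^ a = zeta n ^ b"
proof -
  have 1: "zeta n ^ n = 1" using zeta_power_eq_1_iff[OF assms(1), of n] by simp
  have "zeta n ^ a = zeta n ^ (a mod n)" for a
  proof -
    have "zeta n ^ a = zeta n ^ (n * (a div n) + a mod n)" by simp
    also have "\<dots> = zeta n ^ (a mod n)" unfolding power_add power_mult 1 by simp
    finally show ?thesis .
  qed
  then show ?thesis using assms(2) unfolding cong_def by metis
qed

lemma zeta_nonzero [simp]: "zeta n \<noteq> 0"
  by (simp add: zeta_def)

lemma norm_zeta [simp]: "norm (zeta n) = 1"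
  by (simp add: zeta_def)

lemma sum_zeta_power:
  assumes "n > 0"
  shows "(\<Sum>i<n. zeta n ^ (k * i)) = (if n dvd k then of_nat n else 0)"
proof -
  have "(\<Sum>i<n. zeta n ^ (k * i)) = (\<Sum>i<n. (zeta n ^ k) ^ i)" by (simp add: power_mult)
  also have "\<dots> = (if n dvd k then of_nat n else 0)"
  proof (cases "n dvd k")
    case True
    then show ?thesis using zeta_power_eq_1_iff[OF assms, of k] by simp
  next
    case False
    then have "zeta n ^ k \<noteq> 1" using zeta_power_eq_1_iff[OF assms, of k] by simp
    moreover have "(zeta n ^ k) ^ n = 1"
      using zeta_power_eq_1_iff[OF assms, of "k * n"] by (simp add: power_mult)
    ultimately show ?thesis using False by (simp add: geometric_sum)
  qed
  finally show ?thesis .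
qed

lemma cnj_zeta: "n > 0 \<Longrightarrow> cnj (zeta n) = zeta n ^ (n - 1)"
proof -
  assume n: "n > 0"
  have "zeta n * cnj (zeta n) = 1" by (simp add: complex_mult_cnj zeta_def cmod_power2[symmetric] complex_norm_square[symmetric])
  moreover have "zeta n * zeta n ^ (n - 1) = 1"
    using n zeta_power_eq_1_iff[OF n, of n] by (simp add: power_Suc[symmetric] del: power_Suc)
  ultimately show ?thesis by (metis mult_cancel_left zeta_nonzero)
qed

locale odd_prime =
  fixes p :: nat
  assumes p_prime: "prime p" and p_odd: "odd p"
begin

lemma p_gt_2: "p > 2"
  using p_prime p_odd prime_gt_1_nat[of p] by (cases "p = 2") auto

lemma p_pos: "p > 0" using p_gt_2 by simp

abbreviation "\<zeta> \<equiv> zeta p"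
abbreviation "\<Lambda> \<equiv> lam p"
abbreviation "R \<equiv> Zz p"

lemma zeta_pow_p: "\<zeta> ^ p = 1" using zeta_power_eq_1_iff[OF p_pos, of p] by simp

lemma lam_nonzero: "\<Lambda> \<noteq> 0"
  using zeta_power_eq_1_iff[OF p_pos, of 1] p_gt_2 by (auto simp: lam_def)

text \<open>Expand \<open>(\<Lambda> + 1) ^ p = 1\<close> and cancel one \<open>\<Lambda>\<close>.
  This cyclotomic equation in the variable \<open>\<Lambda>\<close> yields both the independence of
  the powers of \<open>\<zeta>\<close> and the ramification of \<open>p\<close>.\<close>

lemma lam_relation: "(\<Sum>k<p. of_nat (p choose Suc k) * \<Lambda> ^ k) = 0"
proof -
  have "\<Lambda> * (\<Sum>k<p. of_nat (p choose Suc k) * \<Lambda> ^ k) = (\<Sum>k<p. of_nat (p choose Suc k) * \<Lambda> ^ Suc k)"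
    by (simp add: sum_distrib_left mult_ac)
  also have "\<dots> = (\<Sum>k\<le>p. of_nat (p choose k) * \<Lambda> ^ k) - 1"
    unfolding lessThan_Suc_atMost[symmetric] sum.lessThan_Suc_shift by simp
  also have "(\<Sum>k\<le>p. of_nat (p choose k) * \<Lambda> ^ k) = (\<Lambda> + 1) ^ p"
    by (simp add: binomial_ring)
  also have "\<dots> = 1" by (simp add: lam_def zeta_pow_p)
  finally show ?thesis using lam_nonzero by simp
qed

lemma prime_dvd_choose_Suc: "Suc k < p \<Longrightarrow> p dvd (p choose Suc k)"
  using p_prime by (intro dvd_choose_prime) auto

text \<open>The \<open>p\<close>-th cyclotomic polynomial at \<open>X + 1\<close>; the shift makes
  it an Eisenstein polynomial with constant term \<open>p\<close>.\<close>

definition eis_poly :: "int poly" where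
  "eis_poly = (\<Sum>k<p. monom (int (p choose Suc k)) k)"

lemma coeff_eis_poly: "coeff eis_poly k = (if k < p then int (p choose Suc k) else 0)"
  unfolding eis_poly_def by (simp add: coeff_sum)

lemma degree_eis_poly: "degree eis_poly = p - 1"
proof (rule antisym)
  show "degree eis_poly \<le> p - 1" by (rule degree_le) (auto simp: coeff_eis_poly)
  show "p - 1 \<le> degree eis_poly" using p_pos by (intro le_degree) (simp add: coeff_eis_poly)
qed

lemma irreducible_eis_poly: "irreducible eis_poly"
proof (rule eisenstein_irreducible)
  show "prime (int p)" using p_prime by simp
  show "lead_coeff eis_poly = 1" using p_pos by (simp add: degree_eis_poly coeff_eis_poly)
  show "0 < degree eis_poly" using p_gt_2 by (simp add: degree_eis_poly)
  show "int p dvd coeff eis_poly k" if "k < degree eis_poly" for k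
    using that prime_dvd_choose_Suc[of k] by (auto simp: degree_eis_poly coeff_eis_poly)
  show "\<not> (int p)\<^sup>2 dvd coeff eis_poly 0"
    using p_gt_2 by (auto simp: coeff_eis_poly power2_eq_square zdvd_not_zless dest: zdvd_imp_le)
qed

text \<open>The combination is the value at \<open>\<zeta>\<close> of a polynomial of degree at most
  \<open>p - 2\<close>. Composed with \<open>X + 1\<close> it has the root \<open>\<Lambda>\<close>
  and a smaller degree than the irreducible \<open>eis_poly\<close>, so it is zero.\<close>

lemma zeta_int_independent:
  fixes c :: "nat \<Rightarrow> int"
  assumes "(\<Sum>i<p-1. of_int (c i) * \<zeta> ^ i) = 0" and "i < p - 1"
  shows "c i = 0"
proof -
  define f where "f = (\<Sum>i<p-1. monom (c i) i)"
  define g where "g = pcompose f [:1, 1:]"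
  have cf: "coeff f k = (if k < p - 1 then c k else 0)" for k
    unfolding f_def by (simp add: coeff_sum)
  have "degree f \<le> p - 2" by (rule degree_le) (auto simp: cf)
  then have "degree g < degree eis_poly"
    using p_gt_2 by (simp add: g_def degree_pcompose degree_eis_poly)
  moreover have "int_eval f \<zeta> = 0"
    unfolding f_def int_eval_sum int_eval_monom by (rule assms)
  then have "int_eval g \<Lambda> = 0"
    unfolding g_def int_eval_pcompose by (simp add: int_eval_pCons lam_def)
  moreover have "int_eval eis_poly \<Lambda> = 0"
    unfolding eis_poly_def int_eval_sum int_eval_monom using lam_relation by simp
  ultimately have "g = 0" using irreducible_min_degree[OF irreducible_eis_poly] by blast
  then have "f = 0" unfolding g_def by (simp add: pcompose_eq_0_iff)
  then show ?thesis using cf[of i] assms(2) by simp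
qed

lemma sum_zeta: "(\<Sum>i<p. \<zeta> ^ i) = 0"
  using sum_zeta_power[OF p_pos, of 1] p_gt_2 by simp

text \<open>Elements are written with all \<open>p\<close> powers of \<open>\<zeta>\<close>, so
  expansions are ambiguous by a constant added to all coefficients, and by nothing else: normalising
  the last coefficient to 0 leaves the independent powers.\<close>

lemma zeta_int_relation:
  fixes c :: "nat \<Rightarrow> int"
  assumes "(\<Sum>i<p. of_int (c i) * \<zeta> ^ i) = 0" and "i < p"
  shows "c i = c 0"
proof -
  define d where "d i = c i - c (p - 1)" for i
  have "(\<Sum>i<p. of_int (d i) * \<zeta> ^ i) = 
     (\<Sum>i<p. of_int (c i) * \<zeta> ^ i) - of_int (c (p - 1)) * (\<Sum>i<p. \<zeta> ^ i)"
    unfolding sum_distrib_left sum_subtractf[symmetric]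
    by (intro sum.cong) (simp_all add: d_def algebra_simps)
  also have "\<dots> = 0" using assms sum_zeta by simp
  finally have 0: "(\<Sum>i<Suc (p - 1). of_int (d i) * \<zeta> ^ i) = 0" using p_pos by simp
  have "d (p - 1) = 0" by (simp add: d_def)
  then have "(\<Sum>i<p-1. of_int (d i) * \<zeta> ^ i) = 0" using 0 unfolding sum.lessThan_Suc by simp
  then have "d i = 0" if "i < p - 1" for i using zeta_int_independent that by blast
  then have "d i = 0" if "i < p" for i using that \<open>d (p - 1) = 0\<close> by (cases "i = p - 1") auto
  from this[of i] this[of 0] show ?thesis using assms p_pos by (simp add: d_def)
qed

text \<open>The value of \<open>sig\<close> is chosen among rational expansions, so its independence
  of the choice rests on this version. The integer \<open>N\<close> clears all denominators.\<close>

lemma zeta_rat_relation: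
  fixes c :: "nat \<Rightarrow> rat"
  assumes "(\<Sum>i<p. of_rat (c i) * \<zeta> ^ i) = 0" and "i < p"
  shows "c i = c 0"
proof -
  define N where "N = (\<Prod>i<p. snd (quotient_of (c i)))"
  have N: "N \<noteq> 0" unfolding N_def using quotient_of_denom_pos' by (auto simp: less_le)
  have "\<exists>n. of_int N * c i = of_int n" if "i < p" for i
  proof -
    have "snd (quotient_of (c i)) dvd N"
      unfolding N_def by (rule dvd_prodI) (use that in auto)
    then obtain k where k: "N = snd (quotient_of (c i)) * k" by (rule dvdE)
    obtain a b where ab: "quotient_of (c i) = (a, b)" by fastforce
    then have "c i = of_int a / of_int b" "b > 0"
      using quotient_of_div quotient_of_denom_pos by auto
    then have "of_int N * c i = of_int (a * k)" using k ab by simp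
    then show ?thesis by blast
  qed
  then obtain n where n: "\<And>i. i < p \<Longrightarrow> of_int N * c i = of_int (n i)" by metis
  have n': "of_int N * of_rat (c i) = (of_int (n i) :: complex)" if "i < p" for i
    using arg_cong[OF n[OF that], of "of_rat :: rat \<Rightarrow> complex"] by (simp add: of_rat_mult)
  have "(\<Sum>i<p. of_int (n i) * \<zeta> ^ i) = of_int N * (\<Sum>i<p. of_rat (c i) * \<zeta> ^ i)"
    unfolding sum_distrib_left using n' by (intro sum.cong) (auto simp flip: mult.assoc)
  then have "n i = n 0" using zeta_int_relation[of n i] assms by simp
  then have "of_int N * c i = of_int N * c 0" using n[of i] n[of 0] assms p_pos by simp
  then show ?thesis using N by simp
qed

end

section \<open>The ring of cyclotomic integers and its automorphisms\<close>

context odd_prime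
begin

lemma Zz_I: "x = (\<Sum>i<p. of_int (c i) * \<zeta> ^ i) \<Longrightarrow> x \<in> R" for c :: "nat \<Rightarrow> int"
  unfolding Zz_def by (rule CollectI, rule exI)

lemma Zz_add: "x \<in> R \<Longrightarrow> y \<in> R \<Longrightarrow> x + y \<in> R"
proof -
  assume "x \<in> R" "y \<in> R"
  then obtain a b :: "nat \<Rightarrow> int" where ab: "x = (\<Sum>i<p. of_int (a i) * \<zeta> ^ i)" "y = (\<Sum>i<p. of_int (b i) * \<zeta> ^ i)"
    unfolding Zz_def by blast
  have "x + y = (\<Sum>i<p. of_int (a i + b i) * \<zeta> ^ i)"
    unfolding ab by (simp add: sum.distrib distrib_right)
  then show "x + y \<in> R" by (rule Zz_I)
qed

lemma Zz_of_int_mult: "x \<in> R \<Longrightarrow> of_int n * x \<in> R"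
proof -
  assume "x \<in> R"
  then obtain a :: "nat \<Rightarrow> int" where ab: "x = (\<Sum>i<p. of_int (a i) * \<zeta> ^ i)"
    unfolding Zz_def by blast
  have "of_int n * x = (\<Sum>i<p. of_int (n * a i) * \<zeta> ^ i)"
    unfolding ab by (simp add: sum_distrib_left mult_ac)
  then show "of_int n * x \<in> R" by (rule Zz_I)
qed

lemma zeta_power_mod: "\<zeta> ^ (k mod p) = \<zeta> ^ k"
  by (rule zeta_power_cong[OF p_pos]) (simp add: cong_def)

lemma Zz_zeta_power: "\<zeta> ^ k \<in> R"
proof -
  have "\<zeta> ^ k = (\<Sum>i<p. of_int (if i = k mod p then 1 else 0) * \<zeta> ^ i)"
    using p_pos by (simp add: if_distrib[where f = "\<lambda>c. c * _"] if_distrib[where f = of_int] sum.delta zeta_power_mod cong: if_cong)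
  then show ?thesis by (rule Zz_I)
qed

lemma Zz_zeta: "\<zeta> \<in> R" using Zz_zeta_power[of 1] by simp
lemma Zz_1: "1 \<in> R" using Zz_zeta_power[of 0] by simp
lemma Zz_of_int: "of_int n \<in> R" using Zz_of_int_mult[OF Zz_1, of n] by simp
lemma Zz_of_nat: "of_nat n \<in> R" using Zz_of_int[of "int n"] by simp
lemma Zz_0: "0 \<in> R" using Zz_of_int[of 0] by simp
lemma Zz_uminus: "x \<in> R \<Longrightarrow> - x \<in> R" using Zz_of_int_mult[of x "-1"] by simp
lemma Zz_diff: "x \<in> R \<Longrightarrow> y \<in> R \<Longrightarrow> x - y \<in> R" using Zz_add[of x "- y"] Zz_uminus by simp

lemma Zz_sum: "(\<And>i. i \<in> I \<Longrightarrow> f i \<in> R) \<Longrightarrow> sum f I \<in> R"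
  by (induction I rule: infinite_finite_induct) (auto intro: Zz_0 Zz_add)

lemma Zz_induct [consumes 1, case_names zeta_sum]:
  assumes "x \<in> R" "\<And>a :: nat \<Rightarrow> int. P (\<Sum>i<p. of_int (a i) * \<zeta> ^ i)"
  shows "P x"
  using assms unfolding Zz_def by blast

lemma Zz_mult: "x \<in> R \<Longrightarrow> y \<in> R \<Longrightarrow> x * y \<in> R"
proof (induction x rule: Zz_induct)
  case (zeta_sum a)
  show ?case using zeta_sum
  proof (induction y rule: Zz_induct)
    case (zeta_sum b)
    have "(of_int (a i) * \<zeta> ^ i) * (of_int (b j) * \<zeta> ^ j) \<in> R" for i j
      using Zz_of_int_mult[OF Zz_zeta_power[of "i + j"], of "a i * b j"] by (simp add: power_add mult_ac)
    then show ?case unfolding sum_product by (intro Zz_sum)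
  qed
qed

lemma Zz_power: "x \<in> R \<Longrightarrow> x ^ n \<in> R"
  by (induction n) (auto intro: Zz_1 Zz_mult)

lemma Zz_prod: "(\<And>i. i \<in> I \<Longrightarrow> f i \<in> R) \<Longrightarrow> prod f I \<in> R"
  by (induction I rule: infinite_finite_induct) (auto intro: Zz_1 Zz_mult)

lemma Zz_lam: "\<Lambda> \<in> R" unfolding lam_def by (intro Zz_diff Zz_zeta Zz_1)

lemmas Zz_intros = Zz_add Zz_diff Zz_uminus Zz_mult Zz_power Zz_sum Zz_prod
  Zz_zeta Zz_lam Zz_0 Zz_1 Zz_of_int Zz_of_nat

text \<open>Any two rational expansions of the same element differ by a multiple of \<open>1 + \<zeta> + \<dots> + \<zeta> ^ (p - 1)\<close>.\<close>
lemma sig_expansion: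
  fixes c :: "nat \<Rightarrow> rat"
  assumes a: "\<not> p dvd a"
  shows "sig p a (\<Sum>i<p. of_rat (c i) * \<zeta> ^ i) = (\<Sum>i<p. of_rat (c i) * \<zeta> ^ (a * i))"
  unfolding sig_def
proof (rule some_equality)
  fix y
  assume "\<exists>b::nat \<Rightarrow> rat. (\<Sum>i<p. of_rat (c i) * \<zeta> ^ i) = (\<Sum>i<p. of_rat (b i) * \<zeta> ^ i) \<and>
      y = (\<Sum>i<p. of_rat (b i) * \<zeta> ^ (a * i))"
  then obtain b :: "nat \<Rightarrow> rat" where b: "(\<Sum>i<p. of_rat (c i) * \<zeta> ^ i) = (\<Sum>i<p. of_rat (b i) * \<zeta> ^ i)"
      "y = (\<Sum>i<p. of_rat (b i) * \<zeta> ^ (a * i))" by blast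
  have "(\<Sum>i<p. of_rat (b i - c i) * \<zeta> ^ i) = 0"
    using b(1) by (simp add: of_rat_diff left_diff_distrib sum_subtractf)
  then have d: "b i - c i = b 0 - c 0" if "i < p" for i
    using zeta_rat_relation[of "\<lambda>i. b i - c i"] that by blast
  have "y - (\<Sum>i<p. of_rat (c i) * \<zeta> ^ (a * i)) = (\<Sum>i<p. of_rat (b i - c i) * \<zeta> ^ (a * i))"
    unfolding b(2) by (simp add: of_rat_diff left_diff_distrib sum_subtractf)
  also have "\<dots> = (\<Sum>i<p. of_rat (b 0 - c 0) * \<zeta> ^ (a * i))"
    by (intro sum.cong refl, subst d) auto
  also have "\<dots> = of_rat (b 0 - c 0) * (\<Sum>i<p. \<zeta> ^ (a * i))" by (simp only: sum_distrib_left)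
  also have "\<dots> = 0" using a by (simp add: sum_zeta_power[OF p_pos])
  finally show "y = (\<Sum>i<p. of_rat (c i) * \<zeta> ^ (a * i))" by simp
qed (rule exI[of _ c], simp)

lemma sig_int_expansion:
  fixes c :: "nat \<Rightarrow> int"
  assumes a: "\<not> p dvd a"
  shows "sig p a (\<Sum>i<p. of_int (c i) * \<zeta> ^ i) = (\<Sum>i<p. of_int (c i) * \<zeta> ^ (a * i))"
  using sig_expansion[OF a, of "\<lambda>i. of_int (c i)"] by simp

lemma sig_in_Zz:
  assumes a: "\<not> p dvd a" and "x \<in> R"
  shows "sig p a x \<in> R"
  using \<open>x \<in> R\<close>
proof (induction x rule: Zz_induct)
  case (zeta_sum c)
  show ?case unfolding sig_int_expansion[OF a] by (intro Zz_sum Zz_of_int_mult Zz_zeta_power)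
qed

lemma sig_add:
  assumes a: "\<not> p dvd a" and "x \<in> R" "y \<in> R"
  shows "sig p a (x + y) = sig p a x + sig p a y"
  using assms(2)
proof (induction x rule: Zz_induct)
  case (zeta_sum b)
  show ?case using assms(3)
  proof (induction y rule: Zz_induct)
    case (zeta_sum c)
    show ?case using sig_int_expansion[OF a, of "\<lambda>i. b i + c i"]
      by (simp add: sig_int_expansion[OF a] sum.distrib distrib_right)
  qed
qed

lemma sig_of_int_mult:
  assumes a: "\<not> p dvd a" and "x \<in> R"
  shows "sig p a (of_int n * x) = of_int n * sig p a x"
  using assms(2)
proof (induction x rule: Zz_induct)
  case (zeta_sum b)
  show ?case using sig_int_expansion[OF a, of "\<lambda>i. n * b i"]
    by (simp add: sig_int_expansion[OF a] sum_distrib_left mult_ac)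
qed

lemma sig_zeta_power:
  assumes a: "\<not> p dvd a"
  shows "sig p a (\<zeta> ^ k) = \<zeta> ^ (a * k)"
proof -
  have e: "(\<Sum>i<p. of_int (if i = k mod p then 1 else 0) * f i) = f (k mod p)" for f :: "nat \<Rightarrow> complex"
    using p_pos by (simp add: if_distrib[where f = "\<lambda>c. c * _"] if_distrib[where f = of_int] sum.delta cong: if_cong)
  have "sig p a (\<zeta> ^ (k mod p)) = \<zeta> ^ (a * (k mod p))"
    using sig_int_expansion[OF a, of "\<lambda>i. if i = k mod p then 1 else 0"] unfolding e .
  also have "\<dots> = \<zeta> ^ (a * k)"
    by (rule zeta_power_cong[OF p_pos]) (simp add: cong_def mod_simps)
  finally show ?thesis by (simp add: zeta_power_mod)
qed

context
  fixes a assumes a: "\<not> p dvd a"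
begin

lemma sig_of_int: "sig p a (of_int n) = of_int n"
  using sig_of_int_mult[OF a Zz_1, of n] sig_zeta_power[OF a, of 0] by simp

lemma sig_of_nat: "sig p a (of_nat n) = of_nat n"
  using sig_of_int[of "int n"] by simp

lemma sig_0: "sig p a 0 = 0" and sig_1: "sig p a 1 = 1"
  using sig_of_int[of 0] sig_of_int[of 1] by simp_all

lemma sig_uminus: "x \<in> R \<Longrightarrow> sig p a (- x) = - sig p a x"
  using sig_of_int_mult[OF a, of x "-1"] by simp

lemma sig_diff: "x \<in> R \<Longrightarrow> y \<in> R \<Longrightarrow> sig p a (x - y) = sig p a x - sig p a y"
  using sig_add[OF a, of x "- y"] by (simp add: sig_uminus Zz_uminus)

lemma sig_sum: "(\<And>i. i \<in> I \<Longrightarrow> f i \<in> R) \<Longrightarrow> sig p a (sum f I) = (\<Sum>i\<in>I. sig p a (f i))"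
  by (induction I rule: infinite_finite_induct) (simp_all add: sig_0 sig_add[OF a] Zz_sum)

lemma sig_mult:
  assumes "x \<in> R" "y \<in> R"
  shows "sig p a (x * y) = sig p a x * sig p a y"
  using assms(1)
proof (induction x rule: Zz_induct)
  case (zeta_sum b)
  show ?case using assms(2)
  proof (induction y rule: Zz_induct)
    case (zeta_sum c)
    have R: "(of_int (b i) * \<zeta> ^ i) * (of_int (c j) * \<zeta> ^ j) \<in> R" for i j
      by (intro Zz_mult Zz_of_int_mult Zz_zeta_power)
    have "sig p a ((of_int (b i) * \<zeta> ^ i) * (of_int (c j) * \<zeta> ^ j))
        = (of_int (b i) * \<zeta> ^ (a * i)) * (of_int (c j) * \<zeta> ^ (a * j))" for i j
      using sig_of_int_mult[OF a Zz_zeta_power[of "i + j"], of "b i * c j"] sig_zeta_power[OF a, of "i + j"]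
      by (simp add: power_add distrib_left mult_ac)
    then show ?case unfolding sum_product sig_int_expansion[OF a]
      by (simp add: sig_sum Zz_sum R)
  qed
qed

lemma sig_power: "x \<in> R \<Longrightarrow> sig p a (x ^ n) = sig p a x ^ n"
  by (induction n) (simp_all add: sig_1 sig_mult Zz_power)

lemma sig_prod: "(\<And>i. i \<in> I \<Longrightarrow> f i \<in> R) \<Longrightarrow> sig p a (prod f I) = (\<Prod>i\<in>I. sig p a (f i))"
  by (induction I rule: infinite_finite_induct) (simp_all add: sig_1 sig_mult Zz_prod)

end

lemma not_dvd_mult: "\<not> p dvd a \<Longrightarrow> \<not> p dvd b \<Longrightarrow> \<not> p dvd a * b"
  using p_prime by (simp add: prime_dvd_mult_iff)

lemma sig_sig:
  assumes a: "\<not> p dvd a" and b: "\<not> p dvd b" and "x \<in> R"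
  shows "sig p a (sig p b x) = sig p (a * b) x"
  using assms(3)
proof (induction x rule: Zz_induct)
  case (zeta_sum c)
  have "sig p a (\<Sum>i<p. of_int (c i) * \<zeta> ^ (b * i)) = (\<Sum>i<p. of_int (c i) * \<zeta> ^ (a * (b * i)))"
    by (subst sig_sum[OF a])
       (simp_all add: sig_of_int_mult[OF a] Zz_zeta_power Zz_of_int_mult sig_zeta_power[OF a])
  then show ?case by (simp add: sig_int_expansion a b not_dvd_mult mult.assoc)
qed

lemma sig_cong:
  assumes a: "\<not> p dvd a" and ab: "[a = b] (mod p)" and "x \<in> R"
  shows "sig p a x = sig p b x"
  using assms(3)
proof (induction x rule: Zz_induct)
  case (zeta_sum c)
  have b: "\<not> p dvd b" using a ab cong_dvd_iff by blast
  have "\<zeta> ^ (a * i) = \<zeta> ^ (b * i)" for i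
    by (rule zeta_power_cong[OF p_pos]) (intro cong_mult ab cong_refl)
  then show ?case by (simp add: sig_int_expansion a b)
qed

lemma sig_one: "x \<in> R \<Longrightarrow> sig p 1 x = x"
proof (induction x rule: Zz_induct)
  case (zeta_sum c)
  have "\<not> p dvd 1" using p_gt_2 by auto
  then show ?case by (subst sig_int_expansion) simp_all
qed

lemma not_dvd_minus_1: "\<not> p dvd p - 1"
  using p_gt_2 by (auto dest: dvd_imp_le)

lemma cnj_eq_sig: "x \<in> R \<Longrightarrow> cnj x = sig p (p - 1) x"
  by (induction x rule: Zz_induct, unfold sig_int_expansion[OF not_dvd_minus_1])
     (simp add: cnj_zeta[OF p_pos] power_mult)

lemma Zz_cnj: "x \<in> R \<Longrightarrow> cnj x \<in> R"
  using cnj_eq_sig sig_in_Zz[OF not_dvd_minus_1] by simp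

lemma cnj_sig:
  assumes a: "\<not> p dvd a" and x: "x \<in> R"
  shows "cnj (sig p a x) = sig p a (cnj x)"
  unfolding cnj_eq_sig[OF x] cnj_eq_sig[OF sig_in_Zz[OF assms]]
    sig_sig[OF a not_dvd_minus_1 x] sig_sig[OF not_dvd_minus_1 a x] by (simp add: mult.commute)

lemma not_dvd_unit: "a \<in> {1..<p} \<Longrightarrow> \<not> p dvd a"
  by (auto dest: dvd_imp_le)

text \<open>All coefficients of \<open>k * x - n\<close> agree. Of those with index 0 and 1 only the
  first involves \<open>n\<close>, so \<open>k\<close> divides \<open>n\<close>.\<close>

lemma Zz_rational_is_int:
  assumes x: "x \<in> R" and k: "k \<noteq> 0" and eq: "of_int k * x = of_int n"
  shows "\<exists>m. x = of_int m"
proof -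
  obtain a :: "nat \<Rightarrow> int" where a: "x = (\<Sum>i<p. of_int (a i) * \<zeta> ^ i)" using x unfolding Zz_def by blast
  define c where "c i = k * a i - (if i = 0 then n else 0)" for i
  have "(\<Sum>i<p. of_int (c i) * \<zeta> ^ i) = of_int k * x - (\<Sum>i<p. (if i = 0 then of_int n else 0) * \<zeta> ^ i)"
    unfolding a sum_distrib_left sum_subtractf[symmetric]
    by (intro sum.cong) (auto simp: c_def algebra_simps)
  also have "(\<Sum>i<p. (if i = 0 then of_int n else 0) * \<zeta> ^ i) = of_int n"
    using p_pos by (simp add: if_distrib[where f = "\<lambda>c. c * _"] sum.delta cong: if_cong)
  finally have "(\<Sum>i<p. of_int (c i) * \<zeta> ^ i) = 0" using eq by simp
  then have c: "c i = c 0" if "i < p" for i using zeta_int_relation that by blast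
  have "c 1 = c 0" using c[of 1] p_gt_2 by simp
  then have "n = k * (a 0 - a 1)" by (simp add: c_def algebra_simps)
  then have "of_int k * x = of_int k * of_int (a 0 - a 1)" using eq by simp
  then show ?thesis using k by (metis mult_cancel_left of_int_eq_0_iff)
qed

section \<open>The norm down to the integers\<close>

definition cnorm :: "complex \<Rightarrow> complex" where
  "cnorm x = (\<Prod>a\<in>{1..<p}. sig p a x)"

lemma bij_mult_mod:
  assumes b: "\<not> p dvd b"
  shows "bij_betw (\<lambda>a. b * a mod p) {1..<p} {1..<p}"
proof (rule bij_betwI')
  fix x y assume xy: "x \<in> {1..<p}" "y \<in> {1..<p}"
  have "coprime b p" using prime_imp_coprime[OF p_prime b] by (simp add: coprime_commute)
  then show "(b * x mod p = b * y mod p) = (x = y)"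
    using xy cong_mult_lcancel_nat[of b p x y] by (auto simp: cong_def)
next
  fix x assume "x \<in> {1..<p}"
  then have "\<not> p dvd b * x" using b not_dvd_mult not_dvd_unit by blast
  then show "b * x mod p \<in> {1..<p}" using p_pos by (auto simp: dvd_eq_mod_eq_0)
next
  fix y assume y: "y \<in> {1..<p}"
  have "coprime b p" using prime_imp_coprime[OF p_prime b] by (simp add: coprime_commute)
  then obtain c where c: "[b * c = 1] (mod p)" using cong_solve_coprime_nat[of b p] by auto
  have "[b * (c * y mod p) = y] (mod p)"
    using cong_scalar_right[OF c, of y] by (simp add: cong_def mod_simps mult.assoc)
  then have e: "b * (c * y mod p) mod p = y" using y by (simp add: cong_def)
  then have "c * y mod p \<noteq> 0" using y by (intro notI) simp
  then have "c * y mod p \<in> {1..<p}" using p_pos by simp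
  then show "\<exists>x\<in>{1..<p}. y = b * x mod p" using e by metis
qed

lemma sig_cnorm:
  assumes b: "\<not> p dvd b" and x: "x \<in> R"
  shows "sig p b (cnorm x) = cnorm x"
proof -
  have "sig p b (cnorm x) = (\<Prod>a\<in>{1..<p}. sig p b (sig p a x))"
    unfolding cnorm_def by (rule sig_prod[OF b]) (intro sig_in_Zz not_dvd_unit x)
  also have "\<dots> = (\<Prod>a\<in>{1..<p}. sig p (b * a mod p) x)"
  proof (rule prod.cong)
    fix a assume "a \<in> {1..<p}"
    then have a: "\<not> p dvd a" by (rule not_dvd_unit)
    show "sig p b (sig p a x) = sig p (b * a mod p) x"
      unfolding sig_sig[OF b a x]
      by (rule sig_cong) (use x a b in \<open>auto simp: cong_def not_dvd_mult\<close>)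
  qed simp
  also have "\<dots> = cnorm x" unfolding cnorm_def
    using prod.reindex_bij_betw[OF bij_mult_mod[OF b], of "\<lambda>a. sig p a x"] .
  finally show ?thesis .
qed

lemma Zz_cnorm: "x \<in> R \<Longrightarrow> cnorm x \<in> R"
  unfolding cnorm_def by (intro Zz_prod sig_in_Zz not_dvd_unit)

text \<open>For a fixed element the trace equals \<open>(p - 1) * x\<close>. Traces of powers of
  \<open>\<zeta>\<close> are \<open>p - 1\<close> or \<open>- 1\<close>, so \<open>x\<close> is
  rational, hence an integer.\<close>

lemma sig_fixed_is_int:
  assumes x: "x \<in> R" and fix_x: "\<And>a. a \<in> {1..<p} \<Longrightarrow> sig p a x = x"
  shows "\<exists>n. x = of_int n"
proof -
  obtain c :: "nat \<Rightarrow> int" where c: "x = (\<Sum>i<p. of_int (c i) * \<zeta> ^ i)" using x unfolding Zz_def by blast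
  have s: "(\<Sum>a\<in>{1..<p}. \<zeta> ^ (a * i)) = (if p dvd i then of_nat p else 0) - 1" for i
  proof -
    have "(\<Sum>a<p. \<zeta> ^ (i * a)) = 1 + (\<Sum>a\<in>{1..<p}. \<zeta> ^ (i * a))"
      using p_pos by (simp add: lessThan_atLeast0 sum.atLeast_Suc_lessThan)
    then show ?thesis unfolding sum_zeta_power[OF p_pos] by (simp add: mult.commute)
  qed
  have "of_int (int (p - 1)) * x = (\<Sum>a\<in>{1..<p}. sig p a x)" using fix_x by simp
  also have "\<dots> = (\<Sum>a\<in>{1..<p}. \<Sum>i<p. of_int (c i) * \<zeta> ^ (a * i))"
    unfolding c by (intro sum.cong sig_int_expansion not_dvd_unit) auto
  also have "\<dots> = (\<Sum>i<p. of_int (c i) * (\<Sum>a\<in>{1..<p}. \<zeta> ^ (a * i)))"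
    unfolding sum_distrib_left by (rule sum.swap)
  also have "\<dots> = of_int (\<Sum>i<p. c i * ((if p dvd i then int p else 0) - 1))"
    unfolding s of_int_sum by (intro sum.cong) auto
  finally show ?thesis by (rule Zz_rational_is_int[OF x, rotated]) (use p_gt_2 in simp)
qed

lemma cnorm_is_int: "x \<in> R \<Longrightarrow> \<exists>n. cnorm x = of_int n"
  by (rule sig_fixed_is_int) (use Zz_cnorm sig_cnorm not_dvd_unit in blast)+

lemma cnorm_mult: "x \<in> R \<Longrightarrow> y \<in> R \<Longrightarrow> cnorm (x * y) = cnorm x * cnorm y"
  unfolding cnorm_def prod.distrib[symmetric] by (intro prod.cong) (auto intro!: sig_mult not_dvd_unit)

lemma cnorm_power: "x \<in> R \<Longrightarrow> cnorm (x ^ n) = cnorm x ^ n"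
  unfolding cnorm_def prod_power_distrib by (intro prod.cong) (auto intro!: sig_power not_dvd_unit)

lemma cnorm_cnj: "x \<in> R \<Longrightarrow> cnorm (cnj x) = cnorm x"
proof -
  assume x: "x \<in> R"
  have "cnorm (cnj x) = cnj (cnorm x)"
    unfolding cnorm_def cnj_prod by (intro prod.cong refl cnj_sig[symmetric] not_dvd_unit x)
  also have "\<dots> = cnorm x"
    using sig_cnorm[OF not_dvd_minus_1 x] cnj_eq_sig[OF Zz_cnorm[OF x]] by simp
  finally show ?thesis .
qed

lemma dvd_cnorm:
  assumes "x \<in> R"
  shows "\<exists>y\<in>R. cnorm x = x * y"
proof
  have "{1..<p} = insert 1 {2..<p}" using p_gt_2 by auto
  then show "cnorm x = x * (\<Prod>a\<in>{2..<p}. sig p a x)"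
    unfolding cnorm_def using assms by (simp add: sig_one[simplified])
  show "(\<Prod>a\<in>{2..<p}. sig p a x) \<in> R" using assms by (intro Zz_prod sig_in_Zz not_dvd_unit) auto
qed

lemma cnorm_eq_0: 
  assumes "x \<in> R" "cnorm x = 0"
  shows "x = 0"
proof -
  obtain a where a: "a \<in> {1..<p}" "sig p a x = 0" using assms(2) by (auto simp: cnorm_def)
  obtain b where b: "b \<in> {1..<p}" "a * b mod p = 1"
    using bij_mult_mod[OF not_dvd_unit[OF a(1)]] p_gt_2 unfolding bij_betw_def
    by (metis (no_types, lifting) atLeastLessThan_iff imageE le_numeral_extra(4) prime_gt_1_nat p_prime)
  have "x = sig p (b * a) x"
    using sig_cong[of 1 "b * a" x] b p_gt_2 assms sig_one by (simp add: cong_def mult.commute)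
  also have "\<dots> = sig p b (sig p a x)" using sig_sig[OF not_dvd_unit not_dvd_unit] a b assms by metis
  also have "\<dots> = 0" unfolding a(2) by (rule sig_0[OF not_dvd_unit[OF b(1)]])
  finally show ?thesis .
qed

end

section \<open>Congruences modulo powers of the ramified prime\<close>

text \<open>The set \<open>S\<close> records where the correction term lives. It is taken once as
  \<open>R\<close> inside the complex numbers and once as the polynomials with coefficients in
  \<open>R\<close>.\<close>

lemma freshman_dream:
  fixes S :: "'a :: comm_ring_1 set"
  assumes p: "prime p" and one: "1 \<in> S" and zero: "0 \<in> S"
    and add: "\<And>x y. x \<in> S \<Longrightarrow> y \<in> S \<Longrightarrow> x + y \<in> S"
    and mult: "\<And>x y. x \<in> S \<Longrightarrow> y \<in> S \<Longrightarrow> x * y \<in> S"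
    and xy: "x \<in> S" "y \<in> S"
  shows "\<exists>z\<in>S. (x + y) ^ p = x ^ p + y ^ p + of_nat p * z"
proof -
  have pw: "x \<in> S \<Longrightarrow> x ^ n \<in> S" for x n by (induction n) (auto intro: one mult)
  have nat: "of_nat n \<in> S" for n by (induction n) (auto intro: one zero add)
  have sum: "(\<And>i. i \<in> I \<Longrightarrow> f i \<in> S) \<Longrightarrow> sum f I \<in> S" for f and I :: "nat set"
    by (induction I rule: infinite_finite_induct) (auto intro: zero add)
  define z where "z = (\<Sum>k\<in>{1..<p}. of_nat ((p choose k) div p) * x ^ k * y ^ (p - k))"
  have zS: "z \<in> S" unfolding z_def by (intro sum mult pw nat xy)
  have p1: "p > 1" using p by (rule prime_gt_1_nat)
  have "(x + y) ^ p = (\<Sum>k\<le>p. of_nat (p choose k) * x ^ k * y ^ (p - k))" by (rule binomial_ring)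
  also have "{..p} = insert 0 (insert p {1..<p})" by auto
  also have "(\<Sum>k\<in>\<dots>. of_nat (p choose k) * x ^ k * y ^ (p - k)) =
      y ^ p + x ^ p + (\<Sum>k\<in>{1..<p}. of_nat (p choose k) * x ^ k * y ^ (p - k))"
    using p1 by simp
  also have "(\<Sum>k\<in>{1..<p}. of_nat (p choose k) * x ^ k * y ^ (p - k)) = of_nat p * z"
    unfolding z_def sum_distrib_left
  proof (rule sum.cong)
    fix k assume "k \<in> {1..<p}"
    then have "p dvd (p choose k)" using p by (intro dvd_choose_prime) auto
    then have "(of_nat (p choose k) :: 'a) = of_nat p * of_nat ((p choose k) div p)"
      by (simp flip: of_nat_mult)
    then show "of_nat (p choose k) * x ^ k * y ^ (p - k) =
        of_nat p * (of_nat ((p choose k) div p) * x ^ k * y ^ (p - k))"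
      by (simp add: mult.assoc)
  qed simp
  finally show ?thesis using zS by (auto simp: add_ac)
qed

lemma freshman_dream_sum:
  fixes S :: "'a :: comm_ring_1 set"
  assumes p: "prime p" and one: "1 \<in> S" and zero: "0 \<in> S"
    and add: "\<And>x y. x \<in> S \<Longrightarrow> y \<in> S \<Longrightarrow> x + y \<in> S"
    and mult: "\<And>x y. x \<in> S \<Longrightarrow> y \<in> S \<Longrightarrow> x * y \<in> S"
    and I: "finite I" "\<And>i. i \<in> I \<Longrightarrow> f i \<in> S"
  shows "\<exists>z\<in>S. (\<Sum>i\<in>I. f i) ^ p = (\<Sum>i\<in>I. f i ^ p) + of_nat p * z"
  using I
proof (induction I rule: finite_induct)
  case empty
  have "(0 :: 'a) ^ p = 0" using prime_gt_0_nat[OF p] by (simp add: power_0_left)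
  then show ?case using zero by (intro bexI[of _ 0]) auto
next
  case (insert i I)
  then obtain z where z: "z \<in> S" "(\<Sum>i\<in>I. f i) ^ p = (\<Sum>i\<in>I. f i ^ p) + of_nat p * z" by auto
  have sum: "sum f I \<in> S" using insert(1,4) by (induction I rule: finite_induct) (auto intro: zero add)
  obtain w where w: "w \<in> S" "(f i + sum f I) ^ p = f i ^ p + sum f I ^ p + of_nat p * w"
    using freshman_dream[OF p one zero add mult _ sum, of "f i"] insert by auto
  show ?case using insert(1,2) w z
    by (intro bexI[of _ "z + w"]) (auto simp: algebra_simps intro: add)
qed

context odd_prime
begin

lemmas Zz_freshman = freshman_dream[of p R, OF p_prime Zz_1 Zz_0 Zz_add Zz_mult]

lemma lam_pow_p: "\<exists>z\<in>R. \<Lambda> ^ p = of_nat p * z"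
proof -
  obtain z where z: "z \<in> R" "(\<zeta> + (- 1)) ^ p = \<zeta> ^ p + (- 1) ^ p + of_nat p * z"
    using Zz_freshman[of \<zeta> "- 1"] Zz_zeta Zz_uminus[OF Zz_1] by blast
  then show ?thesis using p_odd by (auto simp: lam_def zeta_pow_p)
qed

text \<open>Total ramification of \<open>p\<close> by bootstrapping: the cyclotomic equation reads
  \<open>p = - \<Lambda> ^ (p - 1) - p * \<Lambda> * y\<close>, so a factor
  \<open>\<Lambda> ^ k\<close> of \<open>p\<close> on the right gains one more
  \<open>\<Lambda>\<close>, until the first term sets the limit.\<close>

lemma p_lam_pow:
  assumes "k \<le> p - 1"
  shows "\<exists>w\<in>R. of_nat p = \<Lambda> ^ k * w"
  using assms
proof (induction k)
  case 0
  then show ?case using Zz_of_nat by (intro bexI[of _ "of_nat p"]) auto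
next
  case (Suc k)
  then obtain w where w: "w \<in> R" "of_nat p = \<Lambda> ^ k * w" by auto
  define y where "y = (\<Sum>j\<in>{1..<p-1}. of_nat ((p choose Suc j) div p) * \<Lambda> ^ (j - 1))"
  have yR: "y \<in> R" unfolding y_def by (intro Zz_intros)
  have "{..<p} = insert 0 (insert (p - 1) {1..<p-1})" using p_gt_2 by auto
  then have "0 = of_nat p + \<Lambda> ^ (p - 1) + (\<Sum>j\<in>{1..<p-1}. of_nat (p choose Suc j) * \<Lambda> ^ j)"
    using lam_relation p_gt_2 by (simp add: add.assoc)
  also have "(\<Sum>j\<in>{1..<p-1}. of_nat (p choose Suc j) * \<Lambda> ^ j) = of_nat p * (\<Lambda> * y)"
    unfolding y_def sum_distrib_left
  proof (rule sum.cong)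
    fix j assume j: "j \<in> {1..<p-1}"
    then have "p dvd (p choose Suc j)" by (intro prime_dvd_choose_Suc) auto
    then have e: "(of_nat (p choose Suc j) :: complex) = of_nat p * of_nat ((p choose Suc j) div p)"
      by (simp flip: of_nat_mult)
    have e2: "\<Lambda> ^ j = \<Lambda> * \<Lambda> ^ (j - 1)" using j by (cases j) auto
    show "of_nat (p choose Suc j) * \<Lambda> ^ j =
        of_nat p * (\<Lambda> * (of_nat ((p choose Suc j) div p) * \<Lambda> ^ (j - 1)))"
      unfolding e e2 by (simp only: mult_ac)
  qed simp
  finally have "of_nat p = - (\<Lambda> ^ (p - 1)) - of_nat p * (\<Lambda> * y)" by (simp add: algebra_simps eq_neg_iff_add_eq_0)
  also have "\<Lambda> ^ (p - 1) = \<Lambda> ^ Suc k * \<Lambda> ^ (p - 1 - Suc k)"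
    using Suc.prems by (simp only: power_add[symmetric] le_add_diff_inverse)
  also have "of_nat p * (\<Lambda> * y) = \<Lambda> ^ Suc k * (w * y)" unfolding w(2) by simp
  finally have "of_nat p = \<Lambda> ^ Suc k * (- (\<Lambda> ^ (p - 1 - Suc k)) - w * y)" by (simp add: algebra_simps)
  moreover have "- (\<Lambda> ^ (p - 1 - Suc k)) - w * y \<in> R" using w yR by (intro Zz_intros)
  ultimately show ?case by (rule bexI)
qed

lemma int_dvd_of_Zz:
  assumes "z \<in> R" "of_int n = of_int k * z"
  shows "k dvd n"
proof (cases "k = 0")
  case False
  then obtain m where "z = of_int m" using Zz_rational_is_int[OF assms(1), of k n] assms(2) by auto
  then have "n = k * m" using assms(2) by (metis of_int_eq_iff of_int_mult)
  then show ?thesis by simp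
qed (use assms in auto)

text \<open>\<open>\<Lambda> ^ p\<close> is a multiple of \<open>p\<close>, hence so is
  \<open>n ^ p\<close>, first in \<open>R\<close> and then among the integers.\<close>

lemma int_in_lam_ideal:
  assumes x: "x \<in> R" and eq: "of_int n = \<Lambda> * x"
  shows "int p dvd n"
proof -
  obtain z where z: "z \<in> R" "\<Lambda> ^ p = of_nat p * z" using lam_pow_p by auto
  have "of_int (n ^ p) = of_int (int p) * (z * x ^ p)"
    by (simp add: eq power_mult_distrib z)
  then have "int p dvd n ^ p" using z x by (intro int_dvd_of_Zz[of "z * x ^ p"]) (auto intro: Zz_intros)
  then show ?thesis using p_prime prime_dvd_power[of "int p" n p] by simp
qed

lemma zeta_power_diff_1: "\<exists>y\<in>R. \<zeta> ^ i - 1 = \<Lambda> * y"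
proof -
  have "\<zeta> ^ i - 1 = \<Lambda> * (\<Sum>k<i. \<zeta> ^ k)" unfolding lam_def by (rule power_diff_1_eq)
  then show ?thesis by (auto intro: Zz_intros)
qed

text \<open>The quotient of \<open>\<zeta> ^ j - 1\<close> by \<open>\<Lambda>\<close> is a sum of
  \<open>j\<close> powers of \<open>\<zeta>\<close>, each congruent to 1 modulo
  \<open>\<Lambda>\<close>. If \<open>\<Lambda>\<close> divides it once more, \<open>p\<close>
  divides \<open>j\<close>.\<close>

lemma zeta_power_cong_1:
  assumes x: "x \<in> R" and eq: "\<zeta> ^ j - 1 = \<Lambda>\<^sup>2 * x"
  shows "p dvd j"
proof -
  obtain y where y: "\<And>i. y i \<in> R" "\<And>i. \<zeta> ^ i - 1 = \<Lambda> * y i"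
    using zeta_power_diff_1 by metis
  have "\<Lambda> * (\<Lambda> * x) = \<Lambda> * (\<Sum>k<j. \<zeta> ^ k)"
    using trans[OF eq[symmetric] power_diff_1_eq[of \<zeta> j]]
    unfolding lam_def power2_eq_square mult.assoc .
  then have "\<Lambda> * x = (\<Sum>k<j. \<zeta> ^ k)" using lam_nonzero by simp
  also have "\<dots> = (\<Sum>k<j. 1 + \<Lambda> * y k)" using y(2) by (intro sum.cong) (auto simp: algebra_simps)
  also have "\<dots> = of_nat j + \<Lambda> * (\<Sum>k<j. y k)" by (simp add: sum.distrib sum_distrib_left)
  finally have "of_int (int j) = \<Lambda> * (x - (\<Sum>k<j. y k))" by (simp add: algebra_simps)
  moreover have "x - (\<Sum>k<j. y k) \<in> R" using x y(1) by (intro Zz_intros)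
  ultimately have "int p dvd int j" using int_in_lam_ideal by blast
  then show ?thesis by simp
qed

lemma power_p_cong_1:
  assumes x: "x \<in> R"
  shows "\<exists>z\<in>R. (1 + \<Lambda> * x) ^ p = 1 + of_nat p * z"
proof -
  obtain z where z: "z \<in> R" "(1 + \<Lambda> * x) ^ p = 1 ^ p + (\<Lambda> * x) ^ p + of_nat p * z"
    using Zz_freshman[of 1 "\<Lambda> * x"] x by (auto intro: Zz_intros)
  obtain w where w: "w \<in> R" "\<Lambda> ^ p = of_nat p * w" using lam_pow_p by auto
  show ?thesis using z w x
    by (intro bexI[of _ "w * x ^ p + z"]) (auto simp: power_mult_distrib algebra_simps intro: Zz_intros)
qed

text \<open>Kronecker's theorem for units close to 1: \<open>u ^ p - 1\<close> is divisible by \<open>p\<close>, while all its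
  conjugates have absolute value at most \<open>2 < p\<close>, so its norm vanishes.\<close>
lemma unit_eq_1:
  assumes u: "u \<in> R" and uu: "u * cnj u = 1" and x: "x \<in> R" and ux: "u - 1 = \<Lambda>\<^sup>2 * x"
  shows "u = 1"
proof -
  have "u = 1 + \<Lambda> * (\<Lambda> * x)" using ux by (simp add: power2_eq_square algebra_simps)
  then obtain z where z: "z \<in> R" "u ^ p = 1 + of_nat p * z"
    using power_p_cong_1[of "\<Lambda> * x"] x Zz_mult[OF Zz_lam x] by auto
  have small: "norm (sig p a z) < 1" if "a \<in> {1..<p}" for a
  proof -
    have a: "\<not> p dvd a" using that by (rule not_dvd_unit)
    have "sig p a u * cnj (sig p a u) = 1"
      using sig_mult[OF a u Zz_cnj[OF u]] cnj_sig[OF a u] sig_1[OF a] uu by simp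
    then have "norm (sig p a u * cnj (sig p a u)) = 1" by simp
    then have n1: "norm (sig p a u) = 1"
      by (auto simp: norm_mult power2_eq_square[symmetric] power2_eq_1_iff)
        (smt (verit) norm_ge_zero)
    have "sig p a u ^ p = 1 + of_nat p * sig p a z"
      using arg_cong[OF z(2), of "sig p a"] u z(1)
      by (simp add: sig_power[OF a] sig_add[OF a] sig_mult[OF a] sig_1[OF a] sig_of_nat[OF a] Zz_intros)
    then have "of_nat p * sig p a z = sig p a u ^ p - 1" by simp
    then have "norm (of_nat p * sig p a z) = norm (sig p a u ^ p - 1)" by simp
    also have "\<dots> \<le> norm (sig p a u ^ p) + 1" using norm_triangle_ineq4[of "sig p a u ^ p" 1] by simp
    also have "\<dots> = 2" using n1 by (simp add: norm_power)
    finally have "real p * norm (sig p a z) \<le> 2" by (simp add: norm_mult)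
    moreover have "real p > 2" using p_gt_2 by simp
    ultimately show ?thesis
      by (smt (verit) mult_left_mono mult_cancel_left2 norm_ge_zero)
  qed
  obtain n where n: "cnorm z = of_int n" using cnorm_is_int z by blast
  have "norm (cnorm z) = (\<Prod>a\<in>{1..<p}. norm (sig p a z))" by (simp add: cnorm_def prod_norm)
  also have "\<dots> < (\<Prod>a\<in>{1..<p}. 1)"
    using small p_gt_2 by (intro prod_mono_strict[where i = 1]) (auto simp: less_imp_le)
  finally have "\<bar>n\<bar> < 1" unfolding n by (simp add: of_int_abs[symmetric] del: of_int_abs)
  then have "z = 0" using cnorm_eq_0[OF z(1)] n by simp
  then have "u ^ p = 1" using z by simp
  \<comment> \<open>What remains is a \<open>p\<close>-th root of unity; among these, congruence to
    1 modulo the square of \<open>\<Lambda>\<close> singles out 1.\<close>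
  then obtain j where j: "u = \<zeta> ^ j"
    using bij_betw_roots_unity[OF p_pos] unfolding bij_betw_def zeta_def
    by (force simp: DeMoivre mult_ac)
  then have "p dvd j" using zeta_power_cong_1[OF x] ux by simp
  then show ?thesis using j zeta_power_eq_1_iff[OF p_pos] by simp
qed

lemma cong_pi_of_p_square:
  assumes "z \<in> R" "x - y = of_nat (p\<^sup>2) * z"
  shows "cong_pi p (2 * (p - 1)) x y"
proof -
  obtain w where w: "w \<in> R" "of_nat p = \<Lambda> ^ (p - 1) * w" using p_lam_pow[of "p - 1"] by auto
  have "x - y = (\<Lambda> ^ (p - 1) * w)\<^sup>2 * z" using assms(2) w(2) by simp
  also have "\<dots> = \<Lambda> ^ (2 * (p - 1)) * (w\<^sup>2 * z)" by (simp add: power_mult_distrib power_mult[symmetric] mult_ac)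
  finally have "x - y = \<Lambda> ^ (2 * (p - 1)) * (w\<^sup>2 * z)" .
  moreover have "w\<^sup>2 * z \<in> R" using w(1) assms(1) by (intro Zz_intros)
  ultimately show ?thesis unfolding cong_pi_def by blast
qed

end

section \<open>The residue field of a prime ideal of degree one\<close>

locale degree_one_prime = odd_prime +
  fixes q :: "complex set"
  assumes q_prime: "prime_ideal (Zz p) q" and q_deg1: "prime (ideal_norm (Zz p) q)"
begin

abbreviation l :: nat where "l \<equiv> ideal_norm R q"

lemma q_ideal: "is_ideal R q" and q_proper: "q \<noteq> R"
  using q_prime by (auto simp: prime_ideal_def)

lemma q_subset: "x \<in> q \<Longrightarrow> x \<in> R" and q_0: "0 \<in> q"
  and q_add: "x \<in> q \<Longrightarrow> y \<in> q \<Longrightarrow> x + y \<in> q"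
  and q_mult: "r \<in> R \<Longrightarrow> x \<in> q \<Longrightarrow> r * x \<in> q"
  using q_ideal by (auto simp: is_ideal_def)

lemma q_uminus: "x \<in> q \<Longrightarrow> - x \<in> q"
  using q_mult[OF Zz_uminus[OF Zz_1], of x] by simp

lemma q_diff: "x \<in> q \<Longrightarrow> y \<in> q \<Longrightarrow> x - y \<in> q"
  using q_add[of x "- y"] q_uminus by simp

lemma q_sum: "(\<And>i. i \<in> I \<Longrightarrow> f i \<in> q) \<Longrightarrow> sum f I \<in> q"
  by (induction I rule: infinite_finite_induct) (auto intro: q_0 q_add)

lemma one_notin_q: "1 \<notin> q"
proof
  assume "1 \<in> q"
  then have "x \<in> q" if "x \<in> R" for x using q_mult[OF that, of 1] by simp
  then show False using q_proper q_subset by blast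
qed

definition residue_class :: "complex \<Rightarrow> complex set" where
  "residue_class x = {y \<in> R. x - y \<in> q}"

lemma residue_class_eq_iff:
  assumes "x \<in> R" "y \<in> R"
  shows "residue_class x = residue_class y \<longleftrightarrow> x - y \<in> q"
proof
  assume "residue_class x = residue_class y"
  moreover have "y \<in> residue_class y" using assms q_0 by (simp add: residue_class_def)
  ultimately have "y \<in> residue_class x" by simp
  then show "x - y \<in> q" by (simp add: residue_class_def)
next
  assume xy: "x - y \<in> q"
  have "x - z \<in> q \<longleftrightarrow> y - z \<in> q" for z
    using q_add[OF xy, of "y - z"] q_diff[of "x - z" "x - y"] xy by auto
  then show "residue_class x = residue_class y" by (simp add: residue_class_def)
qed

lemma card_residue_classes: "card (residue_class ` R) = l"
  by (simp add: residue_class_def[abs_def] ideal_norm_def)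

lemma finite_residue_classes: "finite (residue_class ` R)"
proof (rule ccontr)
  assume "infinite (residue_class ` R)"
  \<comment> \<open>An infinite set has \<open>card\<close> 0, so primality of the norm already
    carries the finiteness of the quotient.\<close>
  then have "l = 0" using card_residue_classes by simp
  then show False using q_deg1 by simp
qed

definition char_q :: nat where
  "char_q = (LEAST n. n > 0 \<and> of_nat n \<in> q)"

lemma char_q: "char_q > 0" "of_nat char_q \<in> q"
proof -
  have "\<not> inj_on (\<lambda>n::nat. residue_class (of_nat n)) UNIV"
  proof
    assume "inj_on (\<lambda>n::nat. residue_class (of_nat n)) UNIV"
    moreover have "range (\<lambda>n::nat. residue_class (of_nat n)) \<subseteq> residue_class ` R"
      using Zz_of_nat by auto
    ultimately show False
      using finite_residue_classes by (meson finite_subset finite_imageD infinite_UNIV_nat)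
  qed
  then obtain i j :: nat where ij: "i < j" "residue_class (of_nat j) = residue_class (of_nat i)"
    unfolding inj_on_def by (metis linorder_neqE_nat)
  then have "of_nat (j - i) \<in> q" using residue_class_eq_iff Zz_of_nat by (simp add: of_nat_diff)
  then have "\<exists>n. n > 0 \<and> of_nat n \<in> q" using ij by (intro exI[of _ "j - i"]) simp
  then have "char_q > 0 \<and> of_nat char_q \<in> q" unfolding char_q_def by (rule LeastI_ex)
  then show "char_q > 0" "of_nat char_q \<in> q" by auto
qed

lemma of_int_in_q_iff_char: "of_int n \<in> q \<longleftrightarrow> int char_q dvd n"
proof
  assume "int char_q dvd n"
  then obtain k where "n = k * int char_q" by (metis dvdE mult.commute)
  then show "of_int n \<in> q" using q_mult[OF Zz_of_int[of k] char_q(2)] by simp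
next
  assume n: "of_int n \<in> q"
  define r where "r = nat (n mod int char_q)"
  have r: "int r = n mod int char_q" "r < char_q" using char_q(1) by (auto simp: r_def nat_less_iff)
  have e: "int r = n - n div int char_q * int char_q" using r by (simp add: minus_div_mult_eq_mod)
  have "of_int (int r) = of_int n - of_int (n div int char_q) * (of_nat char_q :: complex)"
    unfolding e by simp
  moreover have "of_int n - of_int (n div int char_q) * of_nat char_q \<in> q"
    using n q_mult[OF Zz_of_int char_q(2)] by (rule q_diff)
  ultimately have "of_nat r \<in> q" by simp
  then have "r = 0" using r(2) not_less_Least[of r "\<lambda>n. n > 0 \<and> of_nat n \<in> q"]
    unfolding char_q_def by auto
  then show "int char_q dvd n" using r by auto
qed

text \<open>The residue classes fall into translates of the set of classes of integers, each of
  cardinality \<open>char_q\<close>; as their number is prime there is only one translate.\<close>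
definition int_block :: "complex \<Rightarrow> complex set set" where
  "int_block x = range (\<lambda>n::int. residue_class (x + of_int n))"

lemma int_block_eq:
  assumes xy: "x \<in> R" "y \<in> R" and z: "z \<in> int_block x" "z \<in> int_block y"
  shows "int_block x \<subseteq> int_block y"
proof
  fix w assume "w \<in> int_block x"
  then obtain k :: int where k: "w = residue_class (x + of_int k)" by (auto simp: int_block_def)
  obtain m n :: int where mn: "z = residue_class (x + of_int m)" "z = residue_class (y + of_int n)"
    using z by (auto simp: int_block_def)
  then have "residue_class (x + of_int m) = residue_class (y + of_int n)" by simp
  then have "(x + of_int m) - (y + of_int n) \<in> q"
    by (subst (asm) residue_class_eq_iff) (use xy in \<open>auto intro: Zz_intros\<close>)
  then have "(x + of_int k) - (y + of_int (n - m + k)) \<in> q" by (simp add: algebra_simps)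
  then have "w = residue_class (y + of_int (n - m + k))"
    unfolding k by (subst residue_class_eq_iff) (use xy in \<open>auto intro: Zz_intros\<close>)
  then show "w \<in> int_block y" unfolding int_block_def by blast
qed

lemma card_int_block:
  assumes "x \<in> R"
  shows "card (int_block x) = char_q"
proof -
  have eq: "residue_class (x + of_int m) = residue_class (x + of_int n) \<longleftrightarrow> int char_q dvd m - n" for m n
    using assms of_int_in_q_iff_char[of "m - n"] by (subst residue_class_eq_iff) (auto intro: Zz_intros)
  have "int_block x = (\<lambda>n. residue_class (x + of_int n)) ` {0..<int char_q}"
  proof
    show "int_block x \<subseteq> (\<lambda>n. residue_class (x + of_int n)) ` {0..<int char_q}"
    proof
      fix w assume "w \<in> int_block x"
      then obtain k :: int where k: "w = residue_class (x + of_int k)" by (auto simp: int_block_def)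
      then have "w = residue_class (x + of_int (k mod int char_q))" unfolding k eq
        by (simp add: minus_mod_eq_mult_div)
      then show "w \<in> (\<lambda>n. residue_class (x + of_int n)) ` {0..<int char_q}"
        using char_q(1) by (auto intro!: imageI)
    qed
  qed (auto simp: int_block_def)
  moreover have "inj_on (\<lambda>n. residue_class (x + of_int n)) {0..<int char_q}"
    unfolding inj_on_def eq by (auto simp: mod_eq_dvd_iff[symmetric])
  ultimately show ?thesis by (simp add: card_image)
qed

lemma char_q_dvd: "char_q * card (int_block ` R) = l"
proof -
  have U: "\<Union> (int_block ` R) = residue_class ` R"
  proof
    show "\<Union> (int_block ` R) \<subseteq> residue_class ` R"
      by (auto simp: int_block_def intro!: imageI Zz_intros)
    show "residue_class ` R \<subseteq> \<Union> (int_block ` R)"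
    proof
      fix w assume "w \<in> residue_class ` R"
      then obtain x where x: "x \<in> R" "w = residue_class x" by auto
      then have "w \<in> int_block x" by (auto simp: int_block_def intro!: range_eqI[of _ _ 0])
      then show "w \<in> \<Union> (int_block ` R)" using x by blast
    qed
  qed
  have fin: "finite (int_block ` R)"
    using U finite_residue_classes by (metis finite_UnionD)
  have "char_q * card (int_block ` R) = card (\<Union> (int_block ` R))"
  proof (rule card_partition[OF fin])
    show "finite (\<Union> (int_block ` R))" unfolding U by (rule finite_residue_classes)
    show "card c = char_q" if "c \<in> int_block ` R" for c using that card_int_block by auto
    show "c1 \<inter> c2 = {}" if c: "c1 \<in> int_block ` R" "c2 \<in> int_block ` R" "c1 \<noteq> c2" for c1 c2
    proof (rule ccontr)
      assume "c1 \<inter> c2 \<noteq> {}"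
      then obtain z where "z \<in> c1" "z \<in> c2" by auto
      moreover obtain x y where "x \<in> R" "y \<in> R" "c1 = int_block x" "c2 = int_block y" using c(1,2) by blast
      ultimately have "c1 = c2" using int_block_eq by (intro equalityI) blast+
      then show False using c by simp
    qed
  qed
  then show ?thesis unfolding U card_residue_classes .
qed

lemma char_q_eq: "char_q = l" "card (int_block ` R) = 1"
proof -
  have "char_q \<noteq> 1" using char_q one_notin_q by auto
  moreover have "char_q dvd l" using char_q_dvd by (metis dvd_triv_left)
  ultimately show "char_q = l" using q_deg1 by (metis prime_nat_iff)
  then show "card (int_block ` R) = 1" using char_q_dvd char_q(1) by simp
qed

lemma of_int_in_q_iff: "of_int n \<in> q \<longleftrightarrow> int l dvd n"
  using of_int_in_q_iff_char char_q_eq by simp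

text \<open>With only one translate of the integer classes, the class of \<open>x\<close> contains
  an integer. Applied to \<open>\<zeta>\<close> it produces the number \<open>r\<close> that
  represents the root of unity modulo \<open>q\<close>.\<close>

lemma ex_int_residue:
  assumes x: "x \<in> R"
  shows "\<exists>n::nat. x - of_nat n \<in> q"
proof -
  have "int_block x = int_block 0"
  proof -
    obtain b where "int_block ` R = {b}" using char_q_eq(2) by (rule card_1_singletonE)
    then show ?thesis using imageI[OF x, of int_block] imageI[OF Zz_0, of int_block] by simp
  qed
  moreover have "residue_class x \<in> int_block x" by (auto simp: int_block_def intro!: range_eqI[of _ _ 0])
  ultimately obtain n :: int where "residue_class x = residue_class (of_int n)" by (auto simp: int_block_def)
  then have n: "x - of_int n \<in> q" using residue_class_eq_iff[OF x Zz_of_int] by blast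
  have "of_int (n - n mod int l) \<in> q" unfolding of_int_in_q_iff by (simp add: minus_mod_eq_mult_div)
  then have "x - of_int n + of_int (n - n mod int l) \<in> q" using n q_add by blast
  then have "x - of_int (n mod int l) \<in> q" by simp
  moreover have "of_int (n mod int l) = (of_nat (nat (n mod int l)) :: complex)"
    using q_deg1 prime_gt_0_nat[OF q_deg1] by simp
  ultimately show ?thesis by metis
qed

lemma ideal_prod_mem: "x \<in> I \<Longrightarrow> y \<in> J \<Longrightarrow> x * y \<in> ideal_prod R I J"
  unfolding ideal_prod_def by auto

lemma power_in_ideal_pow: "x \<in> q \<Longrightarrow> x ^ n \<in> ideal_pow R q n"
  by (induction n) (auto intro: Zz_1 ideal_prod_mem)

lemma ideal_pow_subset: "ideal_pow R q n \<subseteq> R"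
proof (induction n)
  case (Suc n)
  have "is_ideal R R" unfolding is_ideal_def by (auto intro: Zz_intros)
  moreover have "{x * y |x y. x \<in> q \<and> y \<in> ideal_pow R q n} \<subseteq> R"
    using Suc by (blast intro: Zz_mult q_subset)
  ultimately show ?case by (auto simp: ideal_prod_def)
qed simp

lemma ideal_pow_subset_q:
  assumes "n > 0"
  shows "ideal_pow R q n \<subseteq> q"
proof -
  obtain k where n: "n = Suc k" using assms by (cases n) auto
  have "{x * y |x y. x \<in> q \<and> y \<in> ideal_pow R q k} \<subseteq> q"
  proof safe
    fix x y assume "x \<in> q" "y \<in> ideal_pow R q k"
    then show "x * y \<in> q" using q_mult[of y x] ideal_pow_subset[of k] by (auto simp: mult.commute)
  qed
  then show ?thesis unfolding n using q_ideal by (auto simp: ideal_prod_def)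
qed

end

section \<open>The power residue character\<close>

lemma sum_residues_affine:
  fixes h :: "int \<Rightarrow> 'a :: comm_monoid_add" and a c n :: int
  assumes n: "n > 0" and per: "\<And>t. h (t mod n) = h t" and a: "coprime a n"
  shows "(\<Sum>t\<in>{0..<n}. h (a * t + c)) = (\<Sum>t\<in>{0..<n}. h t)"
proof -
  have "inj_on (\<lambda>t. (a * t + c) mod n) {0..<n}"
  proof (rule inj_onI)
    fix s t assume st: "s \<in> {0..<n}" "t \<in> {0..<n}" "(a * s + c) mod n = (a * t + c) mod n"
    then have "[a * s + c = a * t + c] (mod n)" by (simp add: cong_def)
    then have "[a * s = a * t] (mod n)" by (simp add: cong_add_rcancel)
    then have "[s = t] (mod n)" using a by (simp add: cong_mult_lcancel)
    then show "s = t" using st by (simp add: cong_def)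
  qed
  moreover have "(\<lambda>t. (a * t + c) mod n) ` {0..<n} \<subseteq> {0..<n}" using n by auto
  ultimately have "bij_betw (\<lambda>t. (a * t + c) mod n) {0..<n} {0..<n}"
    by (simp add: bij_betw_def endo_inj_surj)
  from sum.reindex_bij_betw[OF this, of h] show ?thesis by (simp add: per)
qed

lemma sum_residues_shift:
  fixes h :: "int \<Rightarrow> 'a :: comm_monoid_add" and c n :: int
  assumes "n > 0" "\<And>t. h (t mod n) = h t"
  shows "(\<Sum>t\<in>{0..<n}. h (t + c)) = (\<Sum>t\<in>{0..<n}. h t)"
  using sum_residues_affine[of n h 1 c] assms by simp

lemma sum_residues_scale:
  fixes h :: "int \<Rightarrow> 'a :: comm_monoid_add" and a n :: int
  assumes "n > 0" "\<And>t. h (t mod n) = h t" "coprime a n"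
  shows "(\<Sum>t\<in>{0..<n}. h (a * t)) = (\<Sum>t\<in>{0..<n}. h t)"
  using sum_residues_affine[of n h a 0] assms by simp

lemma ex_power_not_cong_1:
  assumes l: "prime (l :: nat)" and n: "0 < n" "n < l - 1"
  shows "\<exists>g. \<not> int l dvd g \<and> \<not> [g ^ n = 1] (mod int l)"
proof -
  obtain g where g: "g \<in> totatives l" "ord l g = l - 1"
    using residue_prime_has_primroot[OF l] by auto
  have "\<not> [g ^ n = 1] (mod l)"
    unfolding ord_divides g(2) using n by (auto dest: dvd_imp_le)
  then have "\<not> [int g ^ n = 1] (mod int l)"
    using cong_int_iff[of "g ^ n" 1 l] by simp
  moreover have "\<not> int l dvd int g"
    using g(1) l by (auto simp: totatives_def dest: dvd_imp_le coprime_common_divisor_nat)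
  ultimately show ?thesis by blast
qed

text \<open>Replacing \<open>t\<close> by \<open>g * t\<close> permutes the residues and multiplies
  the sum by \<open>g ^ n\<close>, which for a suitable \<open>g\<close> is not 1 modulo
  \<open>l\<close>. For \<open>n = 0\<close> the convention \<open>0 ^ 0 = 1\<close> makes the sum
  equal to \<open>l\<close>.\<close>

lemma sum_powers_cong_0:
  assumes l: "prime (l :: nat)" and n: "n < l - 1"
  shows "int l dvd (\<Sum>t\<in>{0..<int l}. t ^ n)"
proof (cases "n = 0")
  case False
  obtain g where g: "\<not> int l dvd g" "\<not> [g ^ n = 1] (mod int l)"
    using ex_power_not_cong_1[OF l, of n] n False by auto
  have l0: "int l > 0" using prime_gt_0_nat[OF l] by simp
  have cop: "coprime g (int l)"
    using prime_imp_coprime[of "int l" g] g(1) l by (simp add: coprime_commute)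
  have "(\<Sum>t\<in>{0..<int l}. (g * t) ^ n mod int l) = (\<Sum>t\<in>{0..<int l}. t ^ n mod int l)"
    by (rule sum_residues_scale[OF l0 _ cop]) (simp add: power_mod)
  then have "[(\<Sum>t\<in>{0..<int l}. (g * t) ^ n) = (\<Sum>t\<in>{0..<int l}. t ^ n)] (mod int l)"
    unfolding cong_def by (metis mod_sum_eq)
  then have "[g ^ n * (\<Sum>t\<in>{0..<int l}. t ^ n) = 1 * (\<Sum>t\<in>{0..<int l}. t ^ n)] (mod int l)"
    by (simp add: power_mult_distrib sum_distrib_left)
  then have "int l dvd (g ^ n - 1) * (\<Sum>t\<in>{0..<int l}. t ^ n)"
    by (simp add: cong_iff_dvd_diff algebra_simps)
  then show ?thesis using g(2) l by (simp add: prime_dvd_mult_iff cong_iff_dvd_diff)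
qed simp

text \<open>A Jacobi sum takes this shape modulo \<open>q\<close> once its characters are replaced
  by powers. Expanding the second factor leaves only power sums with exponent below
  \<open>l - 1\<close>.\<close>

lemma sum_beta_cong_0:
  assumes l: "prime (l :: nat)" and mn: "m + n < l - 1"
  shows "int l dvd (\<Sum>t\<in>{0..<int l}. t ^ m * (1 - t) ^ n)"
proof -
  have "(\<Sum>t\<in>{0..<int l}. t ^ m * (1 - t) ^ n)
      = (\<Sum>t\<in>{0..<int l}. \<Sum>k\<le>n. of_nat (n choose k) * (- 1) ^ k * t ^ (m + k))"
  proof (rule sum.cong)
    fix t :: int
    have "(1 - t) ^ n = (- t + 1) ^ n" by simp
    also have "\<dots> = (\<Sum>k\<le>n. of_nat (n choose k) * (- t) ^ k * 1 ^ (n - k))" by (rule binomial_ring)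
    also have "\<dots> = (\<Sum>k\<le>n. of_nat (n choose k) * (- 1) ^ k * t ^ k)"
      by (intro sum.cong refl) (simp add: power_minus[of t])
    finally show "t ^ m * (1 - t) ^ n = (\<Sum>k\<le>n. of_nat (n choose k) * (- 1) ^ k * t ^ (m + k))"
      by (simp add: sum_distrib_left power_add mult_ac)
  qed simp
  also have "\<dots> = (\<Sum>k\<le>n. of_nat (n choose k) * (- 1) ^ k * (\<Sum>t\<in>{0..<int l}. t ^ (m + k)))"
    unfolding sum_distrib_left by (rule sum.swap)
  also have "int l dvd \<dots>"
    using mn by (intro dvd_sum dvd_mult sum_powers_cong_0[OF l]) auto
  finally show ?thesis .
qed

text \<open>Here \<open>r\<close> stands for the residue of \<open>\<zeta>\<close> modulo
  \<open>q\<close>. Only its order modulo \<open>l\<close> enters, so characters and Gauss sums are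
  built without mentioning the ideal.\<close>

locale power_residue_character = odd_prime +
  fixes l r :: nat
  assumes l_prime: "prime l" and r_pow_p: "[r ^ p = 1] (mod l)" and r_not_1: "\<not> [r = 1] (mod l)"
begin

lemma l_pos: "l > 0" using l_prime prime_gt_0_nat by simp
lemma int_l_pos: "int l > 0" using l_pos by simp

lemma ord_r: "ord l r = p"
proof -
  have "ord l r dvd p" using r_pow_p unfolding ord_divides .
  moreover have "ord l r \<noteq> 1" using r_not_1 by (metis One_nat_def ord_eq_Suc_0_iff)
  ultimately show ?thesis using p_prime by (metis prime_nat_iff)
qed

lemma coprime_l_r: "coprime l r"
  using ord_r p_pos by (metis less_irrefl ord_eq_0)

lemma r_power_cong_iff: "[r ^ a = r ^ b] (mod l) \<longleftrightarrow> [a = b] (mod p)"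
  using order_divides_expdiff[OF coprime_l_r, of a b] ord_r by simp

definition f :: nat where "f = (l - 1) div p"

lemma f_mult_p: "f * p = l - 1"
proof -
  have "p dvd l - 1"
    using order_divides_totient[OF coprime_l_r] ord_r l_prime by (simp add: totient_prime)
  then show ?thesis by (simp add: f_def)
qed

lemma f_pos: "f > 0"
  using f_mult_p prime_gt_1_nat[OF l_prime] by (cases "f = 0") auto

text \<open>The powers of \<open>r\<close> are \<open>p\<close> distinct roots of
  \<open>X ^ p - 1\<close> modulo the prime \<open>l\<close>, which admits no more than
  \<open>p\<close>.\<close>

lemma pth_root_is_r_power:
  assumes x: "x < l" and xp: "[x ^ p = 1] (mod l)"
  shows "\<exists>k<p. [r ^ k = x] (mod l)"
proof -
  define X where "X = {x \<in> {..<l}. [x ^ p = 1] (mod l)}"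
  have "card X \<le> p" unfolding X_def by (rule roots_mod_prime_bound[OF l_prime p_pos])
  have im: "(\<lambda>k. r ^ k mod l) ` {..<p} \<subseteq> X"
  proof safe
    fix k
    have "[(r ^ k mod l) ^ p = 1] (mod l)"
      using cong_pow[OF r_pow_p, of k] by (simp add: cong_def power_mod power_mult[symmetric] mult.commute)
    then show "r ^ k mod l \<in> X" using l_pos by (simp add: X_def)
  qed
  have "inj_on (\<lambda>k. r ^ k mod l) {..<p}"
    using r_power_cong_iff by (auto simp: inj_on_def cong_def)
  then have "card ((\<lambda>k. r ^ k mod l) ` {..<p}) = p" by (simp add: card_image)
  moreover have "finite X" by (simp add: X_def)
  ultimately have "(\<lambda>k. r ^ k mod l) ` {..<p} = X" using im \<open>card X \<le> p\<close> by (simp add: card_seteq)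
  moreover have "x \<in> X" using assms by (simp add: X_def)
  ultimately obtain k where k: "k < p" "x = r ^ k mod l" by auto
  then show ?thesis by (intro exI[of _ k]) (auto simp: cong_def)
qed

text \<open>A discrete logarithm to the base \<open>r\<close>, determined modulo \<open>p\<close>
  when \<open>l\<close> does not divide \<open>t\<close>. Since \<open>f * p = l - 1\<close>, the
  exponent \<open>f * (p - 1)\<close> amounts to \<open>- f\<close> modulo \<open>l - 1\<close>;
  this sign makes the character the inverse one. Reducing \<open>t\<close> beforehand builds in the
  periodicity.\<close>

definition E :: "int \<Rightarrow> nat" where
  "E t = (SOME k. [int r ^ k = (t mod int l) ^ (f * (p - 1))] (mod int l))"

lemma E:
  assumes t: "\<not> int l dvd t"
  shows "[int r ^ E t = t ^ (f * (p - 1))] (mod int l)"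
proof -
  define x where "x = nat (t mod int l)"
  have x: "int x = t mod int l" using int_l_pos by (simp add: x_def)
  then have "\<not> l dvd x" using t by (metis dvd_mod_iff dvd_refl int_dvd_int_iff)
  define y where "y = x ^ (f * (p - 1)) mod l"
  have "y < l" using l_pos by (simp add: y_def)
  moreover have "[y ^ p = 1] (mod l)"
  proof -
    have "[x ^ (l - 1) = 1] (mod l)" using fermat_theorem[OF l_prime \<open>\<not> l dvd x\<close>] .
    then have "[(x ^ (l - 1)) ^ (p - 1) = 1 ^ (p - 1)] (mod l)" by (rule cong_pow)
    moreover have "(x ^ (l - 1)) ^ (p - 1) = (x ^ (f * (p - 1))) ^ p"
      unfolding f_mult_p[symmetric] power_mult[symmetric] by (simp add: mult_ac)
    ultimately show ?thesis by (simp add: y_def cong_def power_mod)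
  qed
  ultimately obtain k where "[r ^ k = y] (mod l)" using pth_root_is_r_power by blast
  then have "[r ^ k = x ^ (f * (p - 1))] (mod l)" by (simp add: y_def cong_def)
  then have "[int (r ^ k) = int (x ^ (f * (p - 1)))] (mod int l)" by (simp only: cong_int_iff)
  then have "[int r ^ k = (t mod int l) ^ (f * (p - 1))] (mod int l)" by (simp add: x)
  then have "[int r ^ E t = (t mod int l) ^ (f * (p - 1))] (mod int l)" unfolding E_def by (rule someI)
  then show ?thesis by (simp add: cong_def power_mod)
qed

definition \<chi> :: "int \<Rightarrow> complex" where
  "\<chi> t = (if int l dvd t then 0 else \<zeta> ^ E t)"

lemma chi_eq: "\<not> int l dvd t \<Longrightarrow> \<chi> t = \<zeta> ^ E t" and chi_0: "int l dvd t \<Longrightarrow> \<chi> t = 0"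
  by (simp_all add: \<chi>_def)

lemma Zz_chi: "\<chi> t \<in> R" by (simp add: \<chi>_def Zz_0 Zz_zeta_power)

lemma chi_mod: "\<chi> (t mod int l) = \<chi> t"
  by (simp add: \<chi>_def E_def dvd_mod_iff)

lemma chi_mult: "\<chi> (s * t) = \<chi> s * \<chi> t"
proof (cases "int l dvd s \<or> int l dvd t")
  case True
  then show ?thesis by (auto simp: chi_0)
next
  case False
  then have st: "\<not> int l dvd s * t" using l_prime by (simp add: prime_dvd_mult_iff)
  have "[int r ^ E (s * t) = (s * t) ^ (f * (p - 1))] (mod int l)" using E[OF st] .
  also have "[(s * t) ^ (f * (p - 1)) = int r ^ E s * int r ^ E t] (mod int l)"
    unfolding power_mult_distrib using False by (intro cong_mult cong_sym[OF E]) auto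
  finally have "[int (r ^ E (s * t)) = int (r ^ (E s + E t))] (mod int l)" by (simp add: power_add)
  then have "[E (s * t) = E s + E t] (mod p)" unfolding cong_int_iff r_power_cong_iff .
  then show ?thesis using False st zeta_power_cong[OF p_pos] by (simp add: chi_eq power_add[symmetric])
qed

lemma chi_pow_p: "\<not> int l dvd t \<Longrightarrow> \<chi> t ^ p = 1"
  by (simp add: chi_eq power_mult[symmetric] zeta_power_eq_1_iff[OF p_pos])

lemma chi_nonzero: "\<not> int l dvd t \<Longrightarrow> \<chi> t \<noteq> 0"
  by (simp add: chi_eq)

lemma norm_chi: "\<not> int l dvd t \<Longrightarrow> norm (\<chi> t) = 1"
  by (simp add: chi_eq norm_power)

lemma not_l_dvd_1: "\<not> int l dvd 1" "\<not> int l dvd -1"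
  using prime_gt_1_nat[OF l_prime] by auto

lemma chi_1: "\<chi> 1 = 1"
  using chi_mult[of 1 1] chi_nonzero[OF not_l_dvd_1(1)] by simp

lemma chi_minus_1: "\<chi> (- 1) = 1"
proof -
  have 2: "\<chi> (- 1) ^ 2 = 1" using chi_mult[of "-1" "-1"] chi_1 by (simp add: power2_eq_square)
  obtain k where k: "p = 2 * k + 1" using p_odd by (elim oddE)
  have "\<chi> (- 1) ^ (2 * k + 1) = \<chi> (- 1)" unfolding power_add power_mult 2 by simp
  then have "\<chi> (- 1) ^ p = \<chi> (- 1)" by (simp only: k[symmetric])
  then show ?thesis using chi_pow_p[OF not_l_dvd_1(2)] by simp
qed

lemma chi_uminus: "\<chi> (- t) = \<chi> t"
  using chi_mult[of "-1" t] chi_minus_1 by simp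

text \<open>As \<open>0 < f * (p - 1) < l - 1\<close>, a primitive root is not sent to 1 by this
  exponent, so its logarithm is prime to \<open>p\<close>.\<close>

lemma chi_power_nontrivial:
  assumes "\<not> p dvd k"
  shows "\<exists>t. \<not> int l dvd t \<and> \<chi> t ^ k \<noteq> 1"
proof -
  have "f * (p - 1) < l - 1" unfolding f_mult_p[symmetric] using f_pos p_pos by simp
  moreover have "0 < f * (p - 1)" using f_pos p_gt_2 by simp
  ultimately obtain t where t: "\<not> int l dvd t" "\<not> [t ^ (f * (p - 1)) = 1] (mod int l)"
    using ex_power_not_cong_1[OF l_prime] by blast
  then have "\<not> [int (r ^ E t) = int (r ^ 0)] (mod int l)" using E[OF t(1)] by (auto simp: cong_def)
  then have "\<not> p dvd E t" unfolding cong_int_iff r_power_cong_iff by (simp add: cong_0_iff)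
  then have "\<not> p dvd E t * k" using assms not_dvd_mult by blast
  then have "\<chi> t ^ k \<noteq> 1" using t zeta_power_eq_1_iff[OF p_pos] by (simp add: chi_eq power_mult[symmetric])
  then show ?thesis using t by blast
qed

end

section \<open>Gauss and Jacobi sums\<close>

context power_residue_character
begin

abbreviation F :: "int set" where "F \<equiv> {0..<int l}"

definition \<psi> :: "int \<Rightarrow> complex" where
  "\<psi> t = zeta l ^ nat (t mod int l)"

lemma psi_mod: "\<psi> (t mod int l) = \<psi> t"
  by (simp add: \<psi>_def)

lemma psi_0: "\<psi> 0 = 1" by (simp add: \<psi>_def)

lemma psi_add: "\<psi> (s + t) = \<psi> s * \<psi> t"
proof -
  have "[int (nat ((s + t) mod int l)) = int (nat (s mod int l) + nat (t mod int l))] (mod int l)"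
    using int_l_pos by (simp add: cong_def mod_simps)
  then have "[nat ((s + t) mod int l) = nat (s mod int l) + nat (t mod int l)] (mod l)"
    by (simp only: cong_int_iff)
  from zeta_power_cong[OF l_pos this] show ?thesis by (simp add: \<psi>_def power_add)
qed

lemma psi_eq_1_iff: "\<psi> t = 1 \<longleftrightarrow> int l dvd t"
proof -
  have "l dvd nat (t mod int l) \<longleftrightarrow> int l dvd t"
    using int_l_pos by (metis dvd_mod_iff dvd_refl int_dvd_int_iff int_nat_eq pos_mod_sign)
  then show ?thesis unfolding \<psi>_def by (simp add: zeta_power_eq_1_iff[OF l_pos])
qed

lemma norm_psi: "norm (\<psi> t) = 1"
  by (simp add: \<psi>_def norm_power)

lemma cnj_psi: "cnj (\<psi> t) = \<psi> (- t)"
proof -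
  have "\<psi> t * \<psi> (- t) = 1" using psi_add[of t "- t"] psi_0 by simp
  moreover have "\<psi> t * cnj (\<psi> t) = 1" by (simp add: complex_norm_square[symmetric] norm_psi)
  moreover have "\<psi> t \<noteq> 0" using norm_psi[of t] by auto
  ultimately show ?thesis by (metis mult_cancel_left)
qed

lemma psi_power: "\<psi> t ^ n = \<psi> (t * int n)"
  by (induction n) (simp_all add: psi_0 psi_add distrib_left)

lemma sum_psi: "(\<Sum>t\<in>F. \<psi> (a * t)) = (if int l dvd a then of_nat l else 0)"
proof (cases "int l dvd a")
  case True
  then have "\<psi> (a * t) = 1" for t by (simp add: psi_eq_1_iff)
  then show ?thesis using True by simp
next
  case False
  have "(\<Sum>t\<in>F. \<psi> (a * (t + 1))) = (\<Sum>t\<in>F. \<psi> (a * t))"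
    by (rule sum_residues_shift[OF int_l_pos]) (metis psi_mod mod_mult_right_eq)
  then have "\<psi> a * (\<Sum>t\<in>F. \<psi> (a * t)) = (\<Sum>t\<in>F. \<psi> (a * t))"
    by (simp add: distrib_left psi_add sum_distrib_left mult.commute)
  moreover have "\<psi> a \<noteq> 1" using False by (simp add: psi_eq_1_iff)
  ultimately show ?thesis using False by simp
qed

lemma coprime_F: "\<not> int l dvd a \<Longrightarrow> coprime a (int l)"
  using prime_imp_coprime[of "int l" a] l_prime by (simp add: coprime_commute)

lemma sum_F_split: "(\<Sum>t\<in>F. h t) = h 0 + (\<Sum>t\<in>{1..<int l}. h t)" for h :: "int \<Rightarrow> complex"
proof -
  have "F = insert 0 {1..<int l}" using int_l_pos by auto
  then show ?thesis by simp
qed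

lemma not_dvd_F: "t \<in> {1..<int l} \<Longrightarrow> \<not> int l dvd t"
  by (auto dest: zdvd_imp_le)

text \<open>The twist by \<open>a\<close> allows averaging over all additive characters: that gives
  the absolute value below and, later, the descent of a congruence to \<open>R\<close>.\<close>

definition gauss :: "nat \<Rightarrow> int \<Rightarrow> complex" where
  "gauss k a = (\<Sum>t\<in>F. \<chi> t ^ k * \<psi> (a * t))"

lemma gauss_scale:
  assumes a: "\<not> int l dvd a"
  shows "\<chi> a ^ k * gauss k a = gauss k 1"
proof -
  have "(\<Sum>t\<in>F. \<chi> (a * t) ^ k * \<psi> (a * t)) = (\<Sum>t\<in>F. \<chi> t ^ k * \<psi> t)"
    by (rule sum_residues_scale[OF int_l_pos _ coprime_F[OF a], of "\<lambda>t. \<chi> t ^ k * \<psi> t"])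
       (simp add: chi_mod psi_mod)
  then show ?thesis
    by (simp add: gauss_def chi_mult power_mult_distrib sum_distrib_left mult.assoc)
qed

lemma sum_chi_power:
  assumes "\<not> p dvd k"
  shows "(\<Sum>t\<in>F. \<chi> t ^ k) = 0"
proof -
  obtain a where a: "\<not> int l dvd a" "\<chi> a ^ k \<noteq> 1" using chi_power_nontrivial[OF assms] by auto
  have "(\<Sum>t\<in>F. \<chi> (a * t) ^ k) = (\<Sum>t\<in>F. \<chi> t ^ k)"
    by (rule sum_residues_scale[OF int_l_pos _ coprime_F[OF a(1)], of "\<lambda>t. \<chi> t ^ k"])
       (simp add: chi_mod)
  then have "\<chi> a ^ k * (\<Sum>t\<in>F. \<chi> t ^ k) = (\<Sum>t\<in>F. \<chi> t ^ k)"
    by (simp add: chi_mult power_mult_distrib sum_distrib_left)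
  then show ?thesis using a by simp
qed

lemma gauss_0: "\<not> p dvd k \<Longrightarrow> gauss k 0 = 0"
  by (simp add: gauss_def psi_0 sum_chi_power)

lemma gauss_1_0: "gauss 1 0 = 0"
  by (rule gauss_0) (use p_gt_2 in auto)

abbreviation g :: complex where "g \<equiv> gauss 1 1"
abbreviation G :: complex where "G \<equiv> g ^ p"

text \<open>Sum the squared absolute values of all twists in two ways. Orthogonality gives
  \<open>(l - 1) * l\<close>; by scaling, each of the \<open>l - 1\<close> nonzero twists
  contributes that of \<open>g\<close>, and the zero twist vanishes.\<close>

lemma gauss_mult_cnj: "g * cnj g = of_nat l"
proof -
  have "(\<Sum>a\<in>F. gauss 1 a * cnj (gauss 1 a))
      = (\<Sum>a\<in>F. \<Sum>t\<in>F. \<Sum>u\<in>F. \<chi> t * cnj (\<chi> u) * \<psi> ((t - u) * a))"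
    unfolding gauss_def cnj_sum sum_product
    by (intro sum.cong refl) (simp add: cnj_psi psi_add[symmetric] algebra_simps) 
  also have "\<dots> = (\<Sum>t\<in>F. \<Sum>a\<in>F. \<Sum>u\<in>F. \<chi> t * cnj (\<chi> u) * \<psi> ((t - u) * a))"
    by (rule sum.swap)
  also have "\<dots> = (\<Sum>t\<in>F. \<Sum>u\<in>F. \<Sum>a\<in>F. \<chi> t * cnj (\<chi> u) * \<psi> ((t - u) * a))"
    by (intro sum.cong refl sum.swap)
  also have "\<dots> = (\<Sum>t\<in>F. \<Sum>u\<in>F. \<chi> t * cnj (\<chi> u) * (if int l dvd t - u then of_nat l else 0))"
    unfolding sum_distrib_left[symmetric] sum_psi ..
  also have "\<dots> = (\<Sum>t\<in>F. \<Sum>u\<in>F. if u = t then \<chi> t * cnj (\<chi> t) * of_nat l else 0)"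
  proof (intro sum.cong refl)
    fix t u assume tu: "t \<in> F" "u \<in> F"
    have "int l dvd t - u \<longleftrightarrow> u = t"
    proof
      assume "int l dvd t - u"
      then have "t mod int l = u mod int l" by (simp add: mod_eq_dvd_iff)
      then show "u = t" using tu by simp
    qed simp
    then show "\<chi> t * cnj (\<chi> u) * (if int l dvd t - u then of_nat l else 0) =
        (if u = t then \<chi> t * cnj (\<chi> t) * of_nat l else 0)" by simp
  qed
  also have "\<dots> = (\<Sum>t\<in>F. \<chi> t * cnj (\<chi> t) * of_nat l)" by (simp add: sum.delta)
  also have "\<dots> = (\<Sum>t\<in>{1..<int l}. of_nat l)"
    unfolding sum_F_split using not_dvd_F
    by (auto simp: chi_0 complex_norm_square[symmetric] norm_chi intro!: sum.cong)
  finally have 1: "(\<Sum>a\<in>F. gauss 1 a * cnj (gauss 1 a)) = of_nat (l - 1) * of_nat l" 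
    using l_pos by (simp add: nat_diff_distrib)
  have "(\<Sum>a\<in>F. gauss 1 a * cnj (gauss 1 a)) = (\<Sum>a\<in>{1..<int l}. g * cnj g)"
    unfolding sum_F_split gauss_1_0
  proof -
    have "gauss 1 a * cnj (gauss 1 a) = g * cnj g" if "a \<in> {1..<int l}" for a
    proof -
      have a: "\<not> int l dvd a" using not_dvd_F[OF that] .
      have "g * cnj g = (\<chi> a * cnj (\<chi> a)) * (gauss 1 a * cnj (gauss 1 a))"
        using gauss_scale[OF a, of 1] by (metis complex_cnj_mult mult.assoc mult.left_commute power_one_right)
      then show ?thesis using norm_chi[OF a] by (simp add: complex_norm_square[symmetric])
    qed
    then have "(\<Sum>a\<in>{1..<int l}. gauss 1 a * cnj (gauss 1 a)) = (\<Sum>a\<in>{1..<int l}. g * cnj g)"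
      by (rule sum.cong[OF refl])
    then show "0 * cnj 0 + (\<Sum>a\<in>{1..<int l}. gauss 1 a * cnj (gauss 1 a)) = (\<Sum>a\<in>{1..<int l}. g * cnj g)"
      by simp
  qed
  also have "\<dots> = of_nat (l - 1) * (g * cnj g)" using l_pos by (simp add: nat_diff_distrib)
  finally have "of_nat (l - 1) * (g * cnj g) = of_nat (l - 1) * (of_nat l :: complex)" using 1 by simp
  moreover have "l - 1 \<noteq> 0" using prime_gt_1_nat[OF l_prime] by simp
  ultimately show ?thesis by (metis mult_cancel_left of_nat_eq_0_iff)
qed

section \<open>Jacobi sums and the factorisation of the Gauss sum\<close>

definition J :: "nat \<Rightarrow> complex" where
  "J k = (\<Sum>t\<in>F. \<chi> t * \<chi> (1 - t) ^ k)"

text \<open>Collect the terms of the double sum by \<open>c = t + u\<close>. Scaling by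
  \<open>c\<close> extracts \<open>\<chi> c ^ (k + 1)\<close> from the inner sum when
  \<open>c\<close> is nonzero; the hypothesis on \<open>k + 1\<close> is what removes the terms with
  \<open>c = 0\<close>.\<close>

lemma gauss_mult_gauss:
  assumes k: "\<not> p dvd k + 1"
  shows "g * gauss k 1 = J k * gauss (k + 1) 1"
proof -
  have inner: "(\<Sum>t\<in>F. \<chi> t * \<chi> (c - t) ^ k) = \<chi> c ^ (k + 1) * J k" for c
  proof (cases "int l dvd c")
    case True
    \<comment> \<open>The character is even because \<open>p\<close> is odd, so the inner sum is
      that of the nontrivial character \<open>\<chi> ^ (k + 1)\<close>.\<close>
    have "\<chi> (c - t) = \<chi> t" for t
    proof -
      have "(c - t) mod int l = (- t) mod int l" using True by (metis diff_0 mod_0 mod_diff_left_eq dvd_eq_mod_eq_0)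
      then show ?thesis using chi_mod[of "c - t"] chi_mod[of "- t"] chi_uminus[of t] by simp
    qed
    then show ?thesis using sum_chi_power[OF k] True by (simp add: chi_0)
  next
    case False
    have "(\<Sum>t\<in>F. \<chi> (c * t) * \<chi> (c - c * t) ^ k) = (\<Sum>t\<in>F. \<chi> t * \<chi> (c - t) ^ k)"
      by (rule sum_residues_scale[OF int_l_pos _ coprime_F[OF False], of "\<lambda>t. \<chi> t * \<chi> (c - t) ^ k"])
         (metis chi_mod mod_diff_right_eq)
    moreover have "\<chi> (c * t) * \<chi> (c - c * t) ^ k = \<chi> c ^ (k + 1) * (\<chi> t * \<chi> (1 - t) ^ k)" for t
      using chi_mult[of c t] chi_mult[of c "1 - t"] by (simp add: right_diff_distrib power_mult_distrib)
    ultimately show ?thesis by (simp add: J_def sum_distrib_left)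
  qed
  have "g * gauss k 1 = (\<Sum>t\<in>F. \<Sum>u\<in>F. \<chi> t * \<chi> u ^ k * \<psi> (t + u))"
    unfolding gauss_def sum_product by (simp add: psi_add mult_ac)
  also have "\<dots> = (\<Sum>t\<in>F. \<Sum>c\<in>F. \<chi> t * \<chi> (c - t) ^ k * \<psi> c)"
  proof (rule sum.cong[OF refl])
    fix t
    have "(\<Sum>c\<in>F. \<chi> t * \<chi> (c + (- t)) ^ k * \<psi> (t + (c + (- t)))) = (\<Sum>u\<in>F. \<chi> t * \<chi> u ^ k * \<psi> (t + u))"
      by (rule sum_residues_shift[OF int_l_pos, of "\<lambda>u. \<chi> t * \<chi> u ^ k * \<psi> (t + u)"])
         (metis chi_mod psi_mod mod_add_right_eq)
    then show "(\<Sum>u\<in>F. \<chi> t * \<chi> u ^ k * \<psi> (t + u)) = (\<Sum>c\<in>F. \<chi> t * \<chi> (c - t) ^ k * \<psi> c)" by simp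
  qed
  also have "\<dots> = (\<Sum>c\<in>F. \<Sum>t\<in>F. \<chi> t * \<chi> (c - t) ^ k * \<psi> c)" by (rule sum.swap)
  also have "\<dots> = (\<Sum>c\<in>F. \<chi> c ^ (k + 1) * J k * \<psi> c)"
    unfolding sum_distrib_right[symmetric] inner ..
  also have "\<dots> = J k * gauss (k + 1) 1" by (simp add: gauss_def sum_distrib_left mult_ac)
  finally show ?thesis .
qed

lemma gauss_power:
  assumes "n + 1 < p"
  shows "g ^ (n + 1) = (\<Prod>k\<in>{1..n}. J k) * gauss (n + 1) 1"
  using assms
proof (induction n)
  case (Suc n)
  have "\<not> p dvd Suc n + 1" using Suc.prems by (auto dest: dvd_imp_le)
  then have "g * gauss (n + 1) 1 = J (n + 1) * gauss (n + 2) 1" using gauss_mult_gauss[of "n + 1"] by simp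
  moreover have "g ^ (Suc n + 1) = g * g ^ (n + 1)" by simp
  moreover have "g ^ (n + 1) = (\<Prod>k\<in>{1..n}. J k) * gauss (n + 1) 1" using Suc by simp
  ultimately have "g ^ (Suc n + 1) = (\<Prod>k\<in>{1..n}. J k) * (J (n + 1) * gauss (n + 2) 1)"
    by (metis mult.left_commute)
  then show ?case by simp
qed simp

lemma cnj_gauss: "cnj g = gauss (p - 1) 1"
proof -
  have cnj_chi: "cnj (\<chi> t) = \<chi> t ^ (p - 1)" for t
  proof (cases "int l dvd t")
    case True
    then show ?thesis using p_gt_2 by (simp add: chi_0)
  next
    case False
    have "\<chi> t * cnj (\<chi> t) = 1" using norm_chi[OF False] by (simp add: complex_norm_square[symmetric])
    moreover have "\<chi> t * \<chi> t ^ (p - 1) = 1"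
      using chi_pow_p[OF False] p_pos by (metis power_Suc Suc_diff_1)
    ultimately show ?thesis using chi_nonzero[OF False] by (metis mult_cancel_left)
  qed
  have cop: "coprime (- 1) (int l)" by simp
  have "cnj g = (\<Sum>t\<in>F. \<chi> (- 1 * t) ^ (p - 1) * \<psi> (- 1 * t))"
    unfolding gauss_def by (simp add: cnj_chi cnj_psi chi_uminus)
  also have "\<dots> = gauss (p - 1) 1"
    unfolding gauss_def
    by (subst sum_residues_scale[OF int_l_pos _ cop, of "\<lambda>t. \<chi> t ^ (p - 1) * \<psi> t"])
       (simp_all add: chi_mod psi_mod)
  finally show ?thesis .
qed

text \<open>Climbing one Jacobi sum at a time stops at \<open>gauss (p - 1) 1\<close>, as the next
  step would reach the trivial character. That value is \<open>cnj g\<close>, and the last factor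
  \<open>g\<close> turns it into \<open>l\<close>.\<close>

lemma gauss_pow_p: "G = of_nat l * (\<Prod>k\<in>{1..p-2}. J k)"
proof -
  have e: "Suc (p - 2 + 1) = p" using p_gt_2 by simp
  have "g ^ p = g ^ (p - 2 + 1) * g" using power_Suc2[of g "p - 2 + 1"] unfolding e .
  also have "\<dots> = (\<Prod>k\<in>{1..p-2}. J k) * (cnj g * g)"
    using gauss_power[of "p - 2"] p_gt_2 cnj_gauss by (simp add: numeral_2_eq_2 Suc_diff_Suc)
  also have "cnj g * g = of_nat l" using gauss_mult_cnj by (simp add: mult.commute)
  finally show ?thesis by simp
qed

lemma Zz_J: "J k \<in> R"
  unfolding J_def by (intro Zz_intros Zz_chi)

lemma Zz_G: "G \<in> R"
  unfolding gauss_pow_p by (intro Zz_intros Zz_J)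

lemma G_mult_cnj: "G * cnj G = of_nat l ^ p"
  using gauss_mult_cnj by (metis complex_cnj_power power_mult_distrib)

section \<open>Congruences for the Gauss sum modulo \<open>p\<close> and its square\<close>

lemma sum_F_nat: "(\<Sum>t\<in>F. h t) = (\<Sum>t<l. h (int t))" for h :: "int \<Rightarrow> complex"
proof -
  have "F = int ` {..<l}" by (simp add: image_int_atLeastLessThan lessThan_atLeast0)
  then show ?thesis by (simp add: sum.reindex)
qed

lemma l_eq: "l = 1 + f * p"
  using f_mult_p l_pos by simp

lemma not_l_dvd_p: "\<not> int l dvd int p"
proof
  assume "int l dvd int p"
  then have "l \<le> p" using p_pos by (simp add: dvd_imp_le)
  moreover have "p \<le> f * p" using f_pos by simp
  ultimately show False using l_eq by simp
qed

text \<open>Write \<open>gauss 1 a\<close> as the value at \<open>\<psi> a\<close> of a polynomial with coefficients in \<open>R\<close>. Its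
  \<open>p\<close>-th power is known modulo \<open>p\<close>, and Fourier inversion over \<open>a\<close> brings
  the congruence down to \<open>R\<close>.\<close>
lemma G_cong_minus_1: "\<exists>h\<in>R. G = - 1 + of_nat p * h"
proof -
  \<comment> \<open>Replacing the \<open>l\<close>-th root of unity by an indeterminate keeps the
    coefficients of the remainder in \<open>R\<close>, with no need for the ring generated by both
    roots of unity.\<close>
  define S where "S = {P :: complex poly. \<forall>i. coeff P i \<in> R}"
  define P where "P = (\<Sum>t<l. monom (\<chi> (int t)) t)"
  have "\<exists>z\<in>S. P ^ p = (\<Sum>t<l. monom (\<chi> (int t)) t ^ p) + of_nat p * z"
    unfolding P_def
  proof (rule freshman_dream_sum[OF p_prime])
    show "1 \<in> S" "0 \<in> S" by (auto simp: S_def Zz_0 Zz_1 coeff_1)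
    show "x + y \<in> S" "x * y \<in> S" if "x \<in> S" "y \<in> S" for x y
      using that by (auto simp: S_def coeff_mult intro!: Zz_intros)
    show "monom (\<chi> (int t)) t \<in> S" for t by (simp add: S_def Zz_0 Zz_chi)
  qed simp
  then obtain H where H: "H \<in> S" "P ^ p = (\<Sum>t<l. monom (\<chi> (int t)) t ^ p) + of_nat p * H" by blast
  have P: "poly P (\<psi> a) = gauss 1 a" for a
    by (simp add: P_def poly_sum poly_monom gauss_def sum_F_nat psi_power)
  have eq: "gauss 1 a ^ p = (if int l dvd a then of_nat l else 0) - 1 + of_nat p * poly H (\<psi> a)" for a
  proof -
    have "gauss 1 a ^ p = poly (P ^ p) (\<psi> a)" by (simp add: P)
    also have "\<dots> = (\<Sum>t<l. (\<chi> (int t) * \<psi> (a * int t)) ^ p) + of_nat p * poly H (\<psi> a)"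
      unfolding H(2) by (simp add: poly_sum poly_monom psi_power)
    also have "(\<Sum>t<l. (\<chi> (int t) * \<psi> (a * int t)) ^ p) = (\<Sum>t\<in>F. (\<chi> t * \<psi> (a * t)) ^ p)"
      by (simp add: sum_F_nat)
    also have "\<dots> = (\<Sum>t\<in>{1..<int l}. \<psi> (a * int p * t))"
      unfolding sum_F_split using p_pos not_dvd_F
      by (auto simp: chi_0 power_mult_distrib chi_pow_p psi_power mult_ac intro!: sum.cong)
    also have "\<dots> = (\<Sum>t\<in>F. \<psi> (a * int p * t)) - 1" unfolding sum_F_split by (simp add: psi_0)
    also have "\<dots> = (if int l dvd a then of_nat l else 0) - 1"
      unfolding sum_psi using not_l_dvd_p l_prime by (simp add: prime_dvd_mult_iff)
    finally show ?thesis .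
  qed
  have F_dvd: "int l dvd a \<longleftrightarrow> a = 0" if "a \<in> F" for a
    using that not_dvd_F[of a] by (cases "a = 0") auto
  have psi_minus: "(\<Sum>a\<in>F. \<psi> (- a)) = 0"
    using sum_psi[of "- 1"] not_l_dvd_1 by simp
  \<comment> \<open>The weight matters. Unweighted, the nonzero twists would contribute
    \<open>(l - 1) * G\<close>, and \<open>p\<close> divides \<open>l - 1\<close>; with
    \<open>\<psi> (- a)\<close> the coefficient of \<open>G\<close> becomes
    \<open>- 1\<close>.\<close>
  have "(\<Sum>a\<in>F. \<psi> (- a) * gauss 1 a ^ p) = (\<Sum>a\<in>F. \<psi> (- a) * G) - G"
  proof -
    have "gauss 1 a ^ p = G" if "a \<in> {1..<int l}" for a
    proof -
      have a: "\<not> int l dvd a" using not_dvd_F[OF that] .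
      have "G = (\<chi> a * gauss 1 a) ^ p" using gauss_scale[OF a, of 1] by simp
      then show ?thesis by (simp add: power_mult_distrib chi_pow_p[OF a])
    qed
    then have "(\<Sum>a\<in>{1..<int l}. \<psi> (- a) * gauss 1 a ^ p) = (\<Sum>a\<in>{1..<int l}. \<psi> (- a) * G)"
      by (intro sum.cong refl) metis
    then show ?thesis unfolding sum_F_split gauss_1_0 using p_pos by (simp add: psi_0)
  qed
  also have "\<dots> = - G" unfolding sum_distrib_right[symmetric] psi_minus by simp
  finally have lhs: "(\<Sum>a\<in>F. \<psi> (- a) * gauss 1 a ^ p) = - G" .
  \<comment> \<open>Orthogonality retains exactly the coefficients of \<open>H\<close> whose index
    is 1 modulo \<open>l\<close>.\<close>
  define h where "h = (\<Sum>i\<le>degree H. coeff H i * (if int l dvd int i - 1 then 1 else 0))"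
  have hR: "h \<in> R" unfolding h_def using H(1) by (auto simp: S_def intro!: Zz_intros)
  have "(\<Sum>a\<in>F. \<psi> (- a) * poly H (\<psi> a)) = (\<Sum>a\<in>F. \<Sum>i\<le>degree H. coeff H i * \<psi> ((int i - 1) * a))"
    unfolding poly_altdef sum_distrib_left
  proof (intro sum.cong refl)
    fix a i
    have "\<psi> ((int i - 1) * a) = \<psi> (- a) * \<psi> a ^ i"
      by (simp add: psi_power psi_add[symmetric] algebra_simps)
    then show "\<psi> (- a) * (coeff H i * \<psi> a ^ i) = coeff H i * \<psi> ((int i - 1) * a)" by simp
  qed
  also have "\<dots> = (\<Sum>i\<le>degree H. \<Sum>a\<in>F. coeff H i * \<psi> ((int i - 1) * a))" by (rule sum.swap)
  also have "\<dots> = of_nat l * h"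
    unfolding sum_distrib_left[symmetric] sum_psi h_def
    unfolding sum_distrib_left by (intro sum.cong refl) simp
  finally have fourier: "(\<Sum>a\<in>F. \<psi> (- a) * poly H (\<psi> a)) = of_nat l * h" .
  have "(\<Sum>a\<in>F. \<psi> (- a) * gauss 1 a ^ p) =
      (\<Sum>a\<in>F. (if a = 0 then of_nat l else 0) - \<psi> (- a) + of_nat p * (\<psi> (- a) * poly H (\<psi> a)))"
    unfolding eq by (intro sum.cong refl) (auto simp: F_dvd psi_0 algebra_simps)
  also have "\<dots> = of_nat l - 0 + of_nat p * (of_nat l * h)"
    unfolding sum.distrib sum_subtractf psi_minus sum_distrib_left[symmetric] fourier
    using int_l_pos by (simp add: sum.delta)
  finally have "- G = of_nat l + of_nat p * (of_nat l * h)" unfolding lhs by simp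
  then have "G = - of_nat l - of_nat p * (of_nat l * h)" by (metis add.inverse_inverse minus_add_distrib uminus_add_conv_diff diff_conv_add_uminus)
  \<comment> \<open>The prime \<open>l\<close> is 1 modulo \<open>p\<close>, which turns
    \<open>- l\<close> into \<open>- 1\<close>.\<close>
  also have "(of_nat l :: complex) = 1 + of_nat f * of_nat p" by (subst l_eq) simp
  finally have "G = - 1 + of_nat p * (- of_nat f - (1 + of_nat f * of_nat p) * h)" by (simp add: algebra_simps)
  moreover have "- of_nat f - (1 + of_nat f * of_nat p) * h \<in> R" using hR by (intro Zz_intros)
  ultimately show ?thesis by blast
qed

lemma G_pow_p_cong: "\<exists>h\<in>R. G ^ p = - 1 + of_nat (p\<^sup>2) * h"
proof -
  obtain h where h: "h \<in> R" "G = - 1 + of_nat p * h" using G_cong_minus_1 by blast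
  have "G ^ p = (of_nat p * h + (- 1)) ^ p" using h(2) by simp
  also have "\<dots> = (\<Sum>k\<le>p. of_nat (p choose k) * (of_nat p * h) ^ k * (- 1) ^ (p - k))"
    by (rule binomial_ring)
  \<comment> \<open>The term of index 1 gets its second factor \<open>p\<close> from the binomial
    coefficient, the later ones from the power of \<open>p * h\<close>. Oddness of \<open>p\<close>
    makes the term of index 0 equal to \<open>- 1\<close>.\<close>
  also have "{..p} = insert 0 (insert 1 {2..p})" using p_pos by auto
  also have "(\<Sum>k\<in>\<dots>. of_nat (p choose k) * (of_nat p * h) ^ k * (- 1) ^ (p - k)) =
     - 1 + of_nat p * (of_nat p * h) + (\<Sum>k\<in>{2..p}. of_nat (p choose k) * (of_nat p * h) ^ k * (- 1) ^ (p - k))"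
    using p_odd p_pos by simp
  also have "(\<Sum>k\<in>{2..p}. of_nat (p choose k) * (of_nat p * h) ^ k * (- 1) ^ (p - k)) =
     of_nat (p\<^sup>2) * (\<Sum>k\<in>{2..p}. of_nat (p choose k) * (of_nat p ^ (k - 2) * h ^ k) * (- 1) ^ (p - k))"
    unfolding sum_distrib_left
  proof (rule sum.cong[OF refl])
    fix k assume "k \<in> {2..p}"
    then have "k = 2 + (k - 2)" by (simp only: atLeastAtMost_iff le_add_diff_inverse)
    then have "(of_nat p :: complex) ^ k = of_nat (p\<^sup>2) * of_nat p ^ (k - 2)"
      by (metis of_nat_power power_add)
    then show "of_nat (p choose k) * (of_nat p * h) ^ k * (- 1) ^ (p - k) =
      of_nat (p\<^sup>2) * (of_nat (p choose k) * (of_nat p ^ (k - 2) * h ^ k) * (- 1) ^ (p - k))"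
      unfolding power_mult_distrib by (simp only: mult_ac)
  qed
  finally have "G ^ p = - 1 + of_nat (p\<^sup>2) *
     (h + (\<Sum>k\<in>{2..p}. of_nat (p choose k) * (of_nat p ^ (k - 2) * h ^ k) * (- 1) ^ (p - k)))"
    by (simp add: power2_eq_square algebra_simps)
  moreover have "h + (\<Sum>k\<in>{2..p}. of_nat (p choose k) * (of_nat p ^ (k - 2) * h ^ k) * (- 1) ^ (p - k)) \<in> R"
    using h(1) by (intro Zz_intros)
  ultimately show ?thesis by blast
qed

end

section \<open>Comaximal elements and the Stickelberger element\<close>

context odd_prime
begin

text \<open>Coprimality as a Bezout identity, a form that works without unique factorisation of
  elements.\<close>

definition comaximal :: "complex \<Rightarrow> complex \<Rightarrow> bool" where
  "comaximal x y \<longleftrightarrow> (\<exists>u\<in>R. \<exists>v\<in>R. u * x + v * y = 1)"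

lemma comaximal_sym: "comaximal x y \<Longrightarrow> comaximal y x"
  unfolding comaximal_def by (metis add.commute)

lemma comaximal_1: "comaximal x 1"
  unfolding comaximal_def using Zz_0 Zz_1 by (intro bexI[of _ 0] bexI[of _ 1]) auto

lemma comaximal_mult:
  assumes "comaximal x y" "comaximal x z" "x \<in> R" "y \<in> R" "z \<in> R"
  shows "comaximal x (y * z)"
proof -
  obtain u v where uv: "u \<in> R" "v \<in> R" "u * x + v * y = 1" using assms(1) by (auto simp: comaximal_def)
  obtain s t where st: "s \<in> R" "t \<in> R" "s * x + t * z = 1" using assms(2) by (auto simp: comaximal_def)
  have "(u * x + v * y) * (s * x + t * z) = 1" using uv st by simp
  then have "(u * (s * x + t * z) + v * y * s) * x + (v * t) * (y * z) = 1" by (simp add: algebra_simps)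
  moreover have "u * (s * x + t * z) + v * y * s \<in> R" "v * t \<in> R" using uv st assms by (auto intro!: Zz_intros)
  ultimately show ?thesis unfolding comaximal_def by blast
qed

lemma comaximal_power:
  assumes "comaximal x y" "x \<in> R" "y \<in> R"
  shows "comaximal x (y ^ n)"
  using assms by (induction n) (auto intro: comaximal_1 comaximal_mult Zz_power)

lemma comaximal_powers:
  assumes "comaximal x y" "x \<in> R" "y \<in> R"
  shows "comaximal (x ^ m) (y ^ n)"
  using comaximal_power[OF comaximal_sym[OF comaximal_power[OF assms, of n]], of m] assms
  by (auto intro: comaximal_sym Zz_power)

lemma comaximal_prod:
  assumes "\<And>i. i \<in> I \<Longrightarrow> comaximal x (h i)" "x \<in> R" "\<And>i. i \<in> I \<Longrightarrow> h i \<in> R"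
  shows "comaximal x (prod h I)"
  using assms
  by (induction I rule: infinite_finite_induct) (auto intro: comaximal_1 comaximal_mult Zz_prod)

lemma comaximal_divisor:
  assumes "comaximal (x * s) (y * t)" "s \<in> R" "t \<in> R"
  shows "comaximal x y"
proof -
  obtain u v where "u \<in> R" "v \<in> R" "u * (x * s) + v * (y * t) = 1" using assms(1) by (auto simp: comaximal_def)
  then show ?thesis unfolding comaximal_def using assms
    by (intro bexI[of _ "u * s"] bexI[of _ "v * t"]) (auto simp: mult_ac intro: Zz_mult)
qed

lemma comaximal_prod_divides:
  assumes "finite I" "\<And>i. i \<in> I \<Longrightarrow> h i \<in> R" "\<And>i. i \<in> I \<Longrightarrow> \<exists>z\<in>R. w = h i * z"
    and "\<And>i j. i \<in> I \<Longrightarrow> j \<in> I \<Longrightarrow> i \<noteq> j \<Longrightarrow> comaximal (h i) (h j)" and "w \<in> R"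
  shows "\<exists>z\<in>R. w = prod h I * z"
  using assms
proof (induction I rule: finite_induct)
  case (insert i I)
  then obtain t where t: "t \<in> R" "w = prod h I * t" by auto
  obtain s where s: "s \<in> R" "w = h i * s" using insert(5)[of i] by blast
  have "comaximal (h i) (prod h I)"
    using insert by (intro comaximal_prod) auto
  then obtain u v where uv: "u \<in> R" "v \<in> R" "u * h i + v * prod h I = 1" by (auto simp: comaximal_def)
  \<comment> \<open>Multiply \<open>w\<close> by the Bezout identity and, in each summand, use that
    \<open>w\<close> is divisible by the factor which is absent there.\<close>
  have "w = (u * h i + v * prod h I) * w" using uv by simp
  also have "\<dots> = u * h i * (prod h I * t) + v * prod h I * (h i * s)"
    using t(2) s(2) by (metis distrib_right)
  also have "\<dots> = prod h (insert i I) * (u * t + v * s)"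
    using insert by (simp add: algebra_simps)
  finally show ?case using uv s t by (auto intro: Zz_intros)
qed auto

section \<open>Inverses modulo \<open>p\<close> and the Stickelberger element\<close>

lemma fermat_inverse: "\<not> p dvd b \<Longrightarrow> [b * b ^ (p - 2) = 1] (mod p)"
proof -
  assume b: "\<not> p dvd b"
  have "b * b ^ (p - 2) = b ^ (p - 1)" unfolding power_Suc[symmetric] using p_gt_2 by (intro arg_cong[of _ _ "\<lambda>n. b ^ n"]) simp
  then show ?thesis using fermat_theorem[OF p_prime b] by simp
qed

lemma not_dvd_power: "\<not> p dvd b \<Longrightarrow> \<not> p dvd b ^ n"
  using p_prime prime_dvd_power by blast

lemma sig_sig_inverse:
  assumes b: "\<not> p dvd b" and x: "x \<in> R"
  shows "sig p b (sig p (b ^ (p - 2)) x) = x" "sig p (b ^ (p - 2)) (sig p b x) = x"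
proof -
  have "sig p (b * b ^ (p - 2)) x = sig p 1 x"
    using fermat_inverse[OF b] b x by (intro sig_cong) (auto simp: not_dvd_mult not_dvd_power)
  then have "sig p (b * b ^ (p - 2)) x = x" using sig_one[OF x] by simp
  then show "sig p b (sig p (b ^ (p - 2)) x) = x" "sig p (b ^ (p - 2)) (sig p b x) = x"
    using sig_sig[OF b not_dvd_power[OF b] x] sig_sig[OF not_dvd_power[OF b] b x] by (simp_all add: mult.commute)
qed

lemma power_square_inverse: "\<not> p dvd b \<Longrightarrow> [(b ^ (p - 2)) ^ (p - 2) = b] (mod p)"
proof -
  assume b: "\<not> p dvd b"
  obtain n where n: "p = n + 3" using p_gt_2 by (intro that[of "p - 3"]) simp
  have "(b ^ (p - 2)) ^ (p - 2) = (b ^ (p - 1)) ^ (p - 3) * b"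
    unfolding power_mult[symmetric] by (simp add: n algebra_simps power_add)
  moreover have "[(b ^ (p - 1)) ^ (p - 3) * b = 1 ^ (p - 3) * b] (mod p)"
    by (intro cong_mult cong_pow fermat_theorem p_prime b cong_refl)
  ultimately show ?thesis by simp
qed

lemma bij_inverse_mod: "bij_betw (\<lambda>b. b ^ (p - 2) mod p) {1..<p} {1..<p}"
proof (rule bij_betw_byWitness[where f' = "\<lambda>b. b ^ (p - 2) mod p"])
  show "\<forall>b\<in>{1..<p}. (b ^ (p - 2) mod p) ^ (p - 2) mod p = b"
    using power_square_inverse not_dvd_unit by (auto simp: cong_def power_mod)
  then show "\<forall>b\<in>{1..<p}. (b ^ (p - 2) mod p) ^ (p - 2) mod p = b" .
  have "b ^ (p - 2) mod p \<in> {1..<p}" if "b \<in> {1..<p}" for b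
    using not_dvd_power[OF not_dvd_unit[OF that], of "p - 2"] p_pos by (auto simp: dvd_eq_mod_eq_0)
  then show "(\<lambda>b. b ^ (p - 2) mod p) ` {1..<p} \<subseteq> {1..<p}" "(\<lambda>b. b ^ (p - 2) mod p) ` {1..<p} \<subseteq> {1..<p}" by auto
qed

text \<open>\<open>stick x\<close> is \<open>x ^ P(\<sigma>)\<close>, reindexed by the exponents \<open>b\<close>.\<close>
definition stick :: "complex \<Rightarrow> complex" where
  "stick x = (\<Prod>b\<in>{1..<p}. sig p (b ^ (p - 2)) x ^ b)"

lemma funpow_sig:
  assumes v: "\<not> p dvd v" and x: "x \<in> R"
  shows "(sig p v ^^ i) x = sig p (v ^ i) x"
proof (induction i)
  case 0
  then show ?case using sig_one[OF x] by simp
next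
  case (Suc i)
  then show ?case using sig_sig[OF v not_dvd_power[OF v] x] by simp
qed

text \<open>The exponent, the inverse of \<open>v ^ i\<close> modulo \<open>p\<close>, takes each
  value \<open>b\<close> from 1 to \<open>p - 1\<close> once. The automorphism belonging to
  \<open>b\<close> raises \<open>\<zeta>\<close> to the power \<open>v ^ i\<close>, which is inverse
  to \<open>b\<close>.\<close>

lemma Psig_eq_stick:
  assumes v: "residue_primroot p v" and x: "x \<in> R"
  shows "Psig p v x = stick x"
proof -
  have v0: "\<not> p dvd v"
    using v p_prime by (auto simp: residue_primroot_def)
  have p1: "p > 1" using p_gt_2 by simp
  have "bij_betw (\<lambda>i. v ^ i mod p) {..<p - 1} {1..<p}"
  proof -
    have "totatives p = {1..<p}" unfolding totatives_prime[OF p_prime] by auto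
    then show ?thesis using residue_primroot_is_generator[OF p1 v] p_prime by (simp add: totient_prime)
  qed
  from bij_betw_trans[OF this bij_inverse_mod]
  have bij: "bij_betw (\<lambda>i. v ^ ((p - 2) * i) mod p) {..<p - 1} {1..<p}"
    by (simp add: o_def power_mod power_mult[symmetric] mult.commute)
  have I: "{0..p - 2} = {..<p - 1}" using p_gt_2 by auto
  have "Psig p v x = (\<Prod>i\<in>{..<p - 1}. sig p ((v ^ ((p - 2) * i) mod p) ^ (p - 2)) x ^ (v ^ ((p - 2) * i) mod p))"
    unfolding Psig_def vinvpow_def I
  proof (rule prod.cong[OF refl])
    fix i
    have "[v ^ i = ((v ^ i) ^ (p - 2)) ^ (p - 2)] (mod p)"
      using power_square_inverse[OF not_dvd_power[OF v0]] by (rule cong_sym)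
    also have "[((v ^ i) ^ (p - 2)) ^ (p - 2) = (v ^ ((p - 2) * i) mod p) ^ (p - 2)] (mod p)"
      by (simp add: cong_def power_mod power_mult[symmetric] mult_ac)
    finally have "sig p (v ^ i) x = sig p ((v ^ ((p - 2) * i) mod p) ^ (p - 2)) x"
      by (rule sig_cong[OF not_dvd_power[OF v0] _ x])
    then show "(sig p v ^^ i) x ^ (v ^ ((p - 2) * i) mod p) =
        sig p ((v ^ ((p - 2) * i) mod p) ^ (p - 2)) x ^ (v ^ ((p - 2) * i) mod p)"
      by (simp add: funpow_sig[OF v0 x])
  qed
  also have "\<dots> = stick x" unfolding stick_def
    by (rule prod.reindex_bij_betw[OF bij, of "\<lambda>b. sig p (b ^ (p - 2)) x ^ b"])
  finally show ?thesis .
qed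

text \<open>Every automorphism takes \<open>\<Lambda>\<close> to a multiple of
  \<open>\<Lambda>\<close>, so congruence to 1 modulo its square passes to conjugates, and then to
  products of their powers.\<close>

lemma stick_cong_1:
  assumes x: "x \<in> R" and a: "a \<in> R" and x1: "x - 1 = \<Lambda>\<^sup>2 * a"
  shows "\<exists>y\<in>R. stick x = 1 + \<Lambda>\<^sup>2 * y"
proof -
  define T where "T = {x. \<exists>y\<in>R. x = 1 + \<Lambda>\<^sup>2 * y}"
  have one: "1 \<in> T" unfolding T_def using Zz_0 by (auto intro!: bexI[of _ 0])
  have mult: "s * t \<in> T" if st: "s \<in> T" "t \<in> T" for s t
  proof -
    obtain y z where yz: "y \<in> R" "z \<in> R" "s = 1 + \<Lambda>\<^sup>2 * y" "t = 1 + \<Lambda>\<^sup>2 * z" using st by (auto simp: T_def)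
    then have "s * t = 1 + \<Lambda>\<^sup>2 * (y + z + \<Lambda>\<^sup>2 * y * z)" by (simp add: algebra_simps)
    moreover have "y + z + \<Lambda>\<^sup>2 * y * z \<in> R" using yz by (intro Zz_intros)
    ultimately show ?thesis unfolding T_def by blast
  qed
  have pow: "s ^ n \<in> T" if "s \<in> T" for s n using that by (induction n) (auto intro: one mult)
  have prod: "prod h I \<in> T" if "\<And>i. i \<in> I \<Longrightarrow> h i \<in> T" for h and I :: "nat set"
    using that by (induction I rule: infinite_finite_induct) (auto intro: one mult)
  have sig: "sig p b x \<in> T" if b: "\<not> p dvd b" for b
  proof -
    obtain c where c: "c \<in> R" "\<zeta> ^ b - 1 = \<Lambda> * c" using zeta_power_diff_1 by blast
    have "sig p b \<Lambda> = \<Lambda> * c"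
      unfolding c(2)[symmetric] using sig_diff[OF b Zz_zeta Zz_1] sig_zeta_power[OF b, of 1] sig_1[OF b]
      by (simp add: lam_def)
    then have "sig p b (1 + \<Lambda>\<^sup>2 * a) = 1 + (\<Lambda> * c)\<^sup>2 * sig p b a"
      using a by (simp add: sig_add[OF b] sig_1[OF b] sig_mult[OF b] sig_power[OF b] Zz_intros)
    moreover have "x = 1 + \<Lambda>\<^sup>2 * a" using x1 by (simp add: algebra_simps)
    ultimately have "sig p b x = 1 + \<Lambda>\<^sup>2 * (c\<^sup>2 * sig p b a)" by (simp add: power_mult_distrib mult.assoc)
    moreover have "c\<^sup>2 * sig p b a \<in> R" using c a by (intro Zz_intros sig_in_Zz b)
    ultimately show ?thesis unfolding T_def by blast
  qed
  have "stick x \<in> T" unfolding stick_def by (intro prod pow sig not_dvd_power not_dvd_unit)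
  then show ?thesis by (simp add: T_def)
qed

lemma prod_inverse_conjugates:
  assumes x: "x \<in> R"
  shows "(\<Prod>b\<in>{1..<p}. sig p (b ^ (p - 2)) x) = cnorm x"
proof -
  have "(\<Prod>b\<in>{1..<p}. sig p (b ^ (p - 2)) x) = (\<Prod>b\<in>{1..<p}. sig p (b ^ (p - 2) mod p) x)"
  proof (rule prod.cong[OF refl])
    fix b assume "b \<in> {1..<p}"
    then show "sig p (b ^ (p - 2)) x = sig p (b ^ (p - 2) mod p) x"
      by (intro sig_cong x not_dvd_power not_dvd_unit) (auto simp: cong_def)
  qed
  also have "\<dots> = cnorm x" unfolding cnorm_def
    by (rule prod.reindex_bij_betw[OF bij_inverse_mod, of "\<lambda>b. sig p b x"])
  finally show ?thesis .
qed

text \<open>Complex conjugation turns the conjugate of index \<open>b\<close> into that of index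
  \<open>p - b\<close>, so in the product each conjugate occurs with exponent
  \<open>b + (p - b) = p\<close>.\<close>

lemma stick_mult_cnj:
  assumes x: "x \<in> R"
  shows "stick x * cnj (stick x) = cnorm x ^ p"
proof -
  have bij: "bij_betw (\<lambda>b. p - b) {1..<p} {1..<p}"
    by (rule bij_betw_byWitness[where f' = "\<lambda>b. p - b"]) auto
  have "cnj (stick x) = (\<Prod>b\<in>{1..<p}. sig p ((p - b) ^ (p - 2)) x ^ (p - (p - b)))"
    unfolding stick_def cnj_prod
  proof (rule prod.cong[OF refl])
    fix b assume b: "b \<in> {1..<p}"
    then have nb: "\<not> p dvd b ^ (p - 2)" by (intro not_dvd_power not_dvd_unit)
    have "[int ((p - 1) * b ^ (p - 2)) = int ((p - b) ^ (p - 2))] (mod int p)"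
    proof -
      \<comment> \<open>Since \<open>p - 2\<close> is odd, \<open>- 1\<close> is its own power with
        this exponent, and the sign can be moved inside the inverse
        \<open>b ^ (p - 2)\<close>.\<close>
      have "[int (p - 1) = (- 1) ^ (p - 2)] (mod int p)"
        using p_odd p_gt_2 by (simp add: cong_iff_dvd_diff of_nat_diff)
      then have "[int (p - 1) * int b ^ (p - 2) = (- 1) ^ (p - 2) * int b ^ (p - 2)] (mod int p)"
        by (rule cong_scalar_right)
      also have "(- 1) ^ (p - 2) * int b ^ (p - 2) = (- int b) ^ (p - 2)" by (rule power_minus[symmetric])
      also have "[(- int b) ^ (p - 2) = int (p - b) ^ (p - 2)] (mod int p)"
        using b by (intro cong_pow) (simp add: cong_iff_dvd_diff of_nat_diff)
      finally show ?thesis by simp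
    qed
    then have "[(p - 1) * b ^ (p - 2) = (p - b) ^ (p - 2)] (mod p)" by (simp only: cong_int_iff)
    then have "sig p ((p - 1) * b ^ (p - 2)) x = sig p ((p - b) ^ (p - 2)) x"
      by (rule sig_cong[OF not_dvd_mult[OF not_dvd_minus_1 nb] _ x])
    then have "cnj (sig p (b ^ (p - 2)) x) = sig p ((p - b) ^ (p - 2)) x"
      using cnj_eq_sig[OF sig_in_Zz[OF nb x]] sig_sig[OF not_dvd_minus_1 nb x] by simp
    then show "cnj (sig p (b ^ (p - 2)) x ^ b) = sig p ((p - b) ^ (p - 2)) x ^ (p - (p - b))"
      using b by simp
  qed
  also have "\<dots> = (\<Prod>b\<in>{1..<p}. sig p (b ^ (p - 2)) x ^ (p - b))"
    by (rule prod.reindex_bij_betw[OF bij, of "\<lambda>b. sig p (b ^ (p - 2)) x ^ (p - b)"])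
  finally have "stick x * cnj (stick x) = (\<Prod>b\<in>{1..<p}. sig p (b ^ (p - 2)) x ^ b * sig p (b ^ (p - 2)) x ^ (p - b))"
    unfolding stick_def by (simp add: prod.distrib)
  also have "\<dots> = (\<Prod>b\<in>{1..<p}. sig p (b ^ (p - 2)) x ^ p)"
    by (intro prod.cong refl) (simp flip: power_add)
  also have "\<dots> = cnorm x ^ p" unfolding prod_power_distrib[symmetric] prod_inverse_conjugates[OF x] ..
  finally show ?thesis .
qed

end

section \<open>The Stickelberger relation\<close>

context degree_one_prime
begin

lemma q_cong_mult:
  assumes "x - x' \<in> q" "y - y' \<in> q" "y \<in> R" "x' \<in> R"
  shows "x * y - x' * y' \<in> q"
proof -
  have "x * y - x' * y' = y * (x - x') + x' * (y - y')" by (simp add: algebra_simps)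
  then show ?thesis using assms by (simp add: q_add q_mult)
qed

lemma q_cong_power:
  assumes "x - x' \<in> q" "x \<in> R" "x' \<in> R"
  shows "x ^ n - x' ^ n \<in> q"
  using assms by (induction n) (auto intro: q_0 q_cong_mult Zz_power)

lemma q_cong_of_int: "[m = n] (mod int l) \<Longrightarrow> of_int m - of_int n \<in> q"
  using of_int_in_q_iff[of "m - n"] by (simp add: cong_iff_dvd_diff)

lemma q_cong_trans: "x - y \<in> q \<Longrightarrow> y - z \<in> q \<Longrightarrow> x - z \<in> q"
  using q_add[of "x - y" "y - z"] by simp

end

text \<open>The second assumption keeps \<open>q\<close> apart from the prime above
  \<open>p\<close>; it is what prevents \<open>r\<close> from being 1 modulo
  \<open>l\<close>.\<close>

locale split_prime = degree_one_prime +
  fixes r :: nat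
  assumes zeta_r: "zeta p - of_nat r \<in> q" and lam_notin_q: "lam p \<notin> q"

sublocale split_prime \<subseteq> power_residue_character p "ideal_norm (Zz p) q" r
proof
  show "prime (ideal_norm R q)" by (rule q_deg1)
  have "\<zeta> ^ p - of_nat r ^ p \<in> q" by (rule q_cong_power[OF zeta_r Zz_zeta Zz_of_nat])
  then have "of_int (1 - int r ^ p) \<in> q" by (simp add: zeta_pow_p)
  then have "int l dvd 1 - int r ^ p" by (simp only: of_int_in_q_iff)
  then have "[int (r ^ p) = int 1] (mod int l)" by (simp add: cong_iff_dvd_diff dvd_diff_commute)
  then show "[r ^ p = 1] (mod l)" by (simp only: cong_int_iff)
  show "\<not> [r = 1] (mod l)"
  proof
    assume "[r = 1] (mod l)"
    then have "[int r = int 1] (mod int l)" by (simp only: cong_int_iff)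
    then have "of_int (int r) - of_int (int 1) \<in> q" by (rule q_cong_of_int)
    then have "\<zeta> - 1 \<in> q" using q_cong_trans[OF zeta_r] by simp
    then show False using lam_notin_q by (simp add: lam_def)
  qed
qed

context split_prime
begin

lemma pow_f_mod:
  assumes t: "\<not> int l dvd t"
  shows "[t ^ (f * n) = t ^ (f * (n mod p))] (mod int l)"
proof -
  define x where "x = nat (t mod int l)"
  have x: "int x = t mod int l" using int_l_pos by (simp add: x_def)
  then have nx: "\<not> l dvd x" using t by (metis dvd_mod_iff dvd_refl int_dvd_int_iff)
  have "[int (x ^ (l - 1)) = int 1] (mod int l)"
    unfolding cong_int_iff by (rule fermat_theorem[OF l_prime nx])
  then have 1: "[t ^ (f * p) = 1] (mod int l)"
    unfolding f_mult_p by (simp add: x cong_def power_mod)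
  have "f * n = f * p * (n div p) + f * (n mod p)"
    by (metis distrib_left mult.assoc mult_div_mod_eq)
  then have "t ^ (f * n) = (t ^ (f * p)) ^ (n div p) * t ^ (f * (n mod p))"
    by (simp add: power_add power_mult)
  also have "[\<dots> = 1 ^ (n div p) * t ^ (f * (n mod p))] (mod int l)"
    by (intro cong_mult cong_pow 1 cong_refl)
  finally show ?thesis by simp
qed

text \<open>Modulo \<open>q\<close> a conjugate of the character is a power of \<open>t\<close> with
  exponent \<open>- f * b * k\<close> modulo \<open>l - 1\<close>. Taking the remainder modulo
  \<open>p\<close> keeps the exponent small; being positive, it also makes the congruence correct
  when \<open>l\<close> divides \<open>t\<close>.\<close>

lemma sig_chi_cong:
  assumes b: "\<not> p dvd b" and k: "\<not> p dvd k"
  shows "sig p b (\<chi> t ^ k) - of_int (t ^ (f * ((p - 1) * b * k mod p))) \<in> q"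
proof (cases "int l dvd t")
  case True
  have "(p - 1) * b * k mod p \<noteq> 0"
    using b k not_dvd_minus_1 not_dvd_mult by (metis dvd_eq_mod_eq_0)
  then have "f * ((p - 1) * b * k mod p) > 0" using f_pos by simp
  then have "int l dvd t ^ (f * ((p - 1) * b * k mod p))" using True
    by (metis dvd_power dvd_trans)
  then have "of_int (t ^ (f * ((p - 1) * b * k mod p))) \<in> q" unfolding of_int_in_q_iff .
  from q_diff[OF q_0 this] have "0 - of_int (t ^ (f * ((p - 1) * b * k mod p))) \<in> q" .
  moreover have "k \<noteq> 0" using k by (intro notI) simp
  then have "\<chi> t ^ k = 0" using True by (simp add: chi_0)
  ultimately show ?thesis by (simp only: sig_0[OF b])
next
  case False
  have "sig p b (\<chi> t ^ k) = \<zeta> ^ (E t * (b * k))"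
    using False sig_zeta_power[OF b, of "E t * k"] by (simp add: chi_eq power_mult[symmetric] mult_ac)
  moreover have "\<zeta> ^ (E t * (b * k)) - of_nat r ^ (E t * (b * k)) \<in> q"
    by (rule q_cong_power[OF zeta_r Zz_zeta Zz_of_nat])
  ultimately have 1: "sig p b (\<chi> t ^ k) - of_int (int r ^ (E t * (b * k))) \<in> q" by simp
  have "[(int r ^ E t) ^ (b * k) = (t ^ (f * (p - 1))) ^ (b * k)] (mod int l)"
    using E[OF False] by (rule cong_pow)
  also have "(t ^ (f * (p - 1))) ^ (b * k) = t ^ (f * ((p - 1) * b * k))"
    by (simp add: power_mult[symmetric] mult_ac)
  also have "[t ^ (f * ((p - 1) * b * k)) = t ^ (f * ((p - 1) * b * k mod p))] (mod int l)"
    by (rule pow_f_mod[OF False])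
  finally have "[int r ^ (E t * (b * k)) = t ^ (f * ((p - 1) * b * k mod p))] (mod int l)"
    by (simp add: power_mult)
  from q_cong_trans[OF 1 q_cong_of_int[OF this]] show ?thesis .
qed

text \<open>The conjugate reduces to a beta sum with exponents \<open>f * (p - b)\<close> and
  \<open>f * m\<close>. Their total is below \<open>l - 1 = f * p\<close> precisely when
  \<open>m < b\<close>.\<close>

lemma sig_J_in_q:
  assumes b: "b \<in> {1..<p}" and k: "\<not> p dvd k" and small: "(p - 1) * b * k mod p < b"
  shows "sig p b (J k) \<in> q"
proof -
  have nb: "\<not> p dvd b" using b by (rule not_dvd_unit)
  have n1: "\<not> p dvd 1" using p_gt_2 by auto
  define m where "m = (p - 1) * b * k mod p"
  have m1: "(p - 1) * b * 1 mod p = p - b"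
  proof -
    have "[int ((p - 1) * b) = int (p - b)] (mod int p)"
      using b by (simp add: cong_iff_dvd_diff of_nat_diff algebra_simps)
    then have "[(p - 1) * b = p - b] (mod p)" by (simp only: cong_int_iff)
    then have "(p - 1) * b mod p = (p - b) mod p" by (simp only: cong_def)
    then show ?thesis using b by simp
  qed
  have "sig p b (J k) = (\<Sum>t\<in>F. sig p b (\<chi> t ^ 1) * sig p b (\<chi> (1 - t) ^ k))"
    unfolding J_def by (simp add: sig_sum[OF nb] sig_mult[OF nb] Zz_chi Zz_mult Zz_power)
  then have "sig p b (J k) - of_int (\<Sum>t\<in>F. t ^ (f * (p - b)) * (1 - t) ^ (f * m)) =
     (\<Sum>t\<in>F. sig p b (\<chi> t ^ 1) * sig p b (\<chi> (1 - t) ^ k) - of_int (t ^ (f * (p - b))) * of_int ((1 - t) ^ (f * m)))"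
    by (simp add: sum_subtractf)
  also have "\<dots> \<in> q"
  proof (intro q_sum q_cong_mult)
    fix t
    show "sig p b (\<chi> t ^ 1) - of_int (t ^ (f * (p - b))) \<in> q"
      using sig_chi_cong[OF nb n1, of t] unfolding m1 .
    show "sig p b (\<chi> (1 - t) ^ k) - of_int ((1 - t) ^ (f * m)) \<in> q"
      using sig_chi_cong[OF nb k, of "1 - t"] unfolding m_def .
    show "sig p b (\<chi> (1 - t) ^ k) \<in> R" by (intro sig_in_Zz nb Zz_power Zz_chi)
  qed (rule Zz_of_int)
  finally have 1: "sig p b (J k) - of_int (\<Sum>t\<in>F. t ^ (f * (p - b)) * (1 - t) ^ (f * m)) \<in> q" .
  have "f * (p - b) + f * m < f * p"
    unfolding distrib_left[symmetric] using f_pos small b by (simp add: m_def)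
  then have "int l dvd (\<Sum>t\<in>F. t ^ (f * (p - b)) * (1 - t) ^ (f * m))"
    unfolding f_mult_p by (rule sum_beta_cong_0[OF l_prime])
  then have "of_int (\<Sum>t\<in>F. t ^ (f * (p - b)) * (1 - t) ^ (f * m)) \<in> q" unfolding of_int_in_q_iff .
  from q_add[OF 1 this] show ?thesis by simp
qed

text \<open>Multiplication by \<open>- b\<close> permutes the nonzero residues, so
  \<open>b - 1\<close> of them land below \<open>b\<close>. The index \<open>p - 1\<close> lands on
  \<open>b\<close> itself, so restricting to \<open>k \<le> p - 2\<close> loses none.\<close>

lemma card_small_multiples:
  assumes b: "b \<in> {1..<p}"
  shows "card {k \<in> {1..p-2}. (p - 1) * b * k mod p < b} = b - 1"
proof -
  define m where "m k = (p - 1) * b * k mod p" for k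
  have "\<not> p dvd (p - 1) * b" using not_dvd_mult[OF not_dvd_minus_1 not_dvd_unit[OF b]] .
  then have bij: "bij_betw m {1..<p} {1..<p}" unfolding m_def by (rule bij_mult_mod)
  have last: "m (p - 1) = b"
  proof -
    have "[int (p - 1) = - 1] (mod int p)"
      using p_pos by (simp add: cong_iff_dvd_diff of_nat_diff)
    then have "[int (p - 1) * int b * int (p - 1) = (- 1) * int b * (- 1)] (mod int p)"
      by (intro cong_mult cong_refl)
    then have "[int ((p - 1) * b * (p - 1)) = int b] (mod int p)" by simp
    then have "[(p - 1) * b * (p - 1) = b] (mod p)" by (simp only: cong_int_iff)
    then have "(p - 1) * b * (p - 1) mod p = b mod p" by (simp only: cong_def)
    then show ?thesis using b by (simp add: m_def)
  qed
  have eq: "{k \<in> {1..p-2}. m k < b} = {k \<in> {1..<p}. m k < b}"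
  proof (rule Collect_cong)
    fix k
    show "(k \<in> {1..p-2} \<and> m k < b) = (k \<in> {1..<p} \<and> m k < b)"
    proof (cases "k = p - 1")
      case True
      then show ?thesis using last by simp
    next
      case False
      then show ?thesis using p_gt_2 by auto
    qed
  qed
  have "inj_on m {k \<in> {1..<p}. m k < b}"
    using bij by (auto simp: bij_betw_def intro: inj_on_subset)
  moreover have "m ` {k \<in> {1..<p}. m k < b} = {1..<b}"
  proof
    show "m ` {k \<in> {1..<p}. m k < b} \<subseteq> {1..<b}" using bij by (auto simp: bij_betw_def)
    show "{1..<b} \<subseteq> m ` {k \<in> {1..<p}. m k < b}"
    proof
      fix y assume y: "y \<in> {1..<b}"
      then have "y \<in> m ` {1..<p}" using bij b by (auto simp: bij_betw_def)
      then show "y \<in> m ` {k \<in> {1..<p}. m k < b}" using y by auto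
    qed
  qed
  ultimately have "card {k \<in> {1..<p}. m k < b} = card {1..<b}" by (metis card_image)
  then show ?thesis using eq by (simp add: m_def)
qed

end

locale pth_power_generator = split_prime +
  fixes A :: complex
  assumes A_int: "A \<in> Zz p" and A_gen: "principal (Zz p) A = ideal_pow (Zz p) q p"
begin

abbreviation conj_A :: "nat \<Rightarrow> complex" where "conj_A b \<equiv> sig p (b ^ (p - 2)) A"

text \<open>The bridge from membership in \<open>q\<close> to divisibility of elements: the
  \<open>p\<close>-th power of \<open>sig p b x\<close> lies in the ideal generated by
  \<open>A\<close>, and the inverse automorphism brings the divisibility back to
  \<open>x\<close>.\<close>

lemma conj_A_dvd:
  assumes b: "b \<in> {1..<p}" and x: "x \<in> R" "sig p b x \<in> q"
  shows "\<exists>y\<in>R. x ^ p = conj_A b * y"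
proof -
  have nb: "\<not> p dvd b" using b by (rule not_dvd_unit)
  have nb': "\<not> p dvd b ^ (p - 2)" using nb by (rule not_dvd_power)
  have "sig p b x ^ p \<in> principal R A" unfolding A_gen using x(2) by (rule power_in_ideal_pow)
  then obtain y where y: "y \<in> R" "sig p b x ^ p = A * y" by (auto simp: principal_def)
  have "x ^ p = sig p (b ^ (p - 2)) (sig p b (x ^ p))"
    using sig_sig_inverse(2)[OF nb Zz_power[OF x(1), of p]] by simp
  also have "sig p b (x ^ p) = A * y" using sig_power[OF nb x(1)] y by simp
  also have "sig p (b ^ (p - 2)) (A * y) = conj_A b * sig p (b ^ (p - 2)) y" using sig_mult[OF nb' A_int y(1)] .
  finally show ?thesis using sig_in_Zz[OF nb' y(1)] by blast
qed

lemma Zz_conj_A: "b \<in> {1..<p} \<Longrightarrow> conj_A b \<in> R"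
  by (intro sig_in_Zz A_int not_dvd_power not_dvd_unit)

lemma of_nat_l_dvd:
  assumes b: "b \<in> {1..<p}"
  shows "\<exists>y\<in>R. of_nat l ^ p = conj_A b * y"
proof (rule conj_A_dvd[OF b Zz_of_nat])
  show "sig p b (of_nat l) \<in> q"
    using of_int_in_q_iff[of "int l"] by (simp add: sig_of_nat[OF not_dvd_unit[OF b]])
qed

text \<open>Of the \<open>b\<close> factors, \<open>b - 1\<close> come from the Jacobi sums with
  small index and one from the rational factor \<open>l\<close>.\<close>

lemma conj_A_power_dvd_G:
  assumes b: "b \<in> {1..<p}"
  shows "\<exists>y\<in>R. G ^ p = conj_A b ^ b * y"
proof -
  define K where "K = {k \<in> {1..p-2}. (p - 1) * b * k mod p < b}"
  have "\<exists>y\<in>R. J k ^ p = conj_A b * y" if "k \<in> K" for k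
  proof (rule conj_A_dvd[OF b Zz_J])
    have "\<not> p dvd k" using that by (intro not_dvd_unit) (auto simp: K_def)
    then show "sig p b (J k) \<in> q" using that by (intro sig_J_in_q b) (auto simp: K_def)
  qed
  then obtain y where y: "\<And>k. k \<in> K \<Longrightarrow> y k \<in> R" "\<And>k. k \<in> K \<Longrightarrow> J k ^ p = conj_A b * y k" by metis
  obtain w where w: "w \<in> R" "of_nat l ^ p = conj_A b * w" using of_nat_l_dvd[OF b] by blast
  have fin: "finite {1..p-2}" "K \<subseteq> {1..p-2}" by (auto simp: K_def)
  have "G ^ p = of_nat l ^ p * (\<Prod>k\<in>{1..p-2}. J k ^ p)"
    unfolding gauss_pow_p power_mult_distrib prod_power_distrib ..
  also have "(\<Prod>k\<in>{1..p-2}. J k ^ p) = (\<Prod>k\<in>{1..p-2} - K. J k ^ p) * (\<Prod>k\<in>K. J k ^ p)"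
    by (rule prod.subset_diff[OF fin(2,1)])
  also have "(\<Prod>k\<in>K. J k ^ p) = (\<Prod>k\<in>K. conj_A b * y k)" using y by (intro prod.cong) auto
  also have "\<dots> = conj_A b ^ (b - 1) * (\<Prod>k\<in>K. y k)"
    unfolding prod.distrib prod_constant using card_small_multiples[OF b] by (simp only: K_def)
  also have "of_nat l ^ p * ((\<Prod>k\<in>{1..p-2} - K. J k ^ p) * (conj_A b ^ (b - 1) * (\<Prod>k\<in>K. y k)))
     = (conj_A b * conj_A b ^ (b - 1)) * (w * (\<Prod>k\<in>{1..p-2} - K. J k ^ p) * (\<Prod>k\<in>K. y k))"
    unfolding w(2) by (simp only: mult_ac)
  also have "conj_A b * conj_A b ^ (b - 1) = conj_A b ^ b" using b by (cases b) auto
  finally have "G ^ p = conj_A b ^ b * (w * (\<Prod>k\<in>{1..p-2} - K. J k ^ p) * (\<Prod>k\<in>K. y k))" .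
  moreover have "w * (\<Prod>k\<in>{1..p-2} - K. J k ^ p) * (\<Prod>k\<in>K. y k) \<in> R"
    using w y by (intro Zz_intros Zz_J)
  ultimately show ?thesis by blast
qed

text \<open>The preimages of \<open>q\<close> under the two automorphisms contain \<open>l\<close>
  together with \<open>\<zeta> - r ^ b\<close> and \<open>\<zeta> - r ^ c\<close> respectively. As
  \<open>r ^ b - r ^ c\<close> is invertible modulo \<open>l\<close>, elements \<open>X\<close> and
  \<open>Y\<close> of these ideals add up to 1; their \<open>p\<close>-th powers are comaximal
  multiples of the conjugates of \<open>A\<close>.\<close>

lemma conj_A_comaximal:
  assumes b: "b \<in> {1..<p}" and c: "c \<in> {1..<p}" and bc: "b \<noteq> c"
  shows "comaximal (conj_A b) (conj_A c)"
proof -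
  have root: "sig p a (\<zeta> - of_nat (r ^ a)) \<in> q" if "a \<in> {1..<p}" for a
  proof -
    have a: "\<not> p dvd a" using that by (rule not_dvd_unit)
    have "sig p a (\<zeta> - of_nat (r ^ a)) = \<zeta> ^ a - of_nat (r ^ a)"
      using sig_diff[OF a Zz_zeta Zz_of_nat] sig_zeta_power[OF a, of 1] sig_of_nat[OF a] by (simp del: of_nat_power)
    then show ?thesis using q_cong_power[OF zeta_r Zz_zeta Zz_of_nat, of a] by simp
  qed
  have "\<not> [r ^ b = r ^ c] (mod l)" using b c bc unfolding r_power_cong_iff by (simp add: cong_def)
  then have "\<not> [int (r ^ b) = int (r ^ c)] (mod int l)" by (simp only: cong_int_iff not_False_eq_True)
  then have "\<not> int l dvd int (r ^ b) - int (r ^ c)" by (simp only: cong_iff_dvd_diff not_False_eq_True)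
  then have "coprime (int (r ^ b) - int (r ^ c)) (int l)" by (rule coprime_F)
  then obtain s t where st: "(int (r ^ b) - int (r ^ c)) * s + int l * t = 1"
    using bezout_int[of "int (r ^ b) - int (r ^ c)" "int l"] by (auto simp: mult.commute)
  define X where "X = of_int (- s) * (\<zeta> - of_nat (r ^ b)) + of_int t * of_nat l"
  define Y where "Y = of_int s * (\<zeta> - of_nat (r ^ c))"
  have XY: "X \<in> R" "Y \<in> R" unfolding X_def Y_def by (intro Zz_intros)+
  have "X + Y = of_int ((int (r ^ b) - int (r ^ c)) * s + int l * t)"
    unfolding X_def Y_def by (simp add: algebra_simps)
  then have "X + Y = 1" unfolding st by simp
  then have "comaximal X Y" unfolding comaximal_def using Zz_1 by (intro bexI[of _ 1]) auto
  then have cm: "comaximal (X ^ p) (Y ^ p)" using XY by (rule comaximal_powers)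
  have nb: "\<not> p dvd b" and nc: "\<not> p dvd c" using b c not_dvd_unit by blast+
  have "sig p b X = of_int (- s) * sig p b (\<zeta> - of_nat (r ^ b)) + of_int t * of_int (int l)"
    unfolding X_def by (subst sig_add[OF nb]) (auto simp: sig_of_int_mult[OF nb] sig_mult[OF nb] sig_of_int[OF nb] sig_of_nat[OF nb] sig_uminus[OF nb] Zz_intros simp del: of_int_minus)
  then have "sig p b X \<in> q" using root[OF b] of_int_in_q_iff[of "int l"]
    by (simp only: q_add q_mult Zz_of_int dvd_refl)
  then obtain x where x: "x \<in> R" "X ^ p = conj_A b * x" using conj_A_dvd[OF b XY(1)] by blast
  have "sig p c Y = of_int s * sig p c (\<zeta> - of_nat (r ^ c))"
    unfolding Y_def by (rule sig_of_int_mult[OF nc]) (intro Zz_intros)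
  then have "sig p c Y \<in> q" using root[OF c] q_mult[OF Zz_of_int] by simp
  then obtain y where y: "y \<in> R" "Y ^ p = conj_A c * y" using conj_A_dvd[OF c XY(2)] by blast
  show ?thesis using cm x y comaximal_divisor by simp
qed

lemma stick_dvd_G: "\<exists>y\<in>R. G ^ p = stick A * y"
  unfolding stick_def
proof (rule comaximal_prod_divides)
  show "comaximal (conj_A i ^ i) (conj_A j ^ j)" if "i \<in> {1..<p}" "j \<in> {1..<p}" "i \<noteq> j" for i j
    using that by (intro comaximal_powers conj_A_comaximal Zz_conj_A)
  show "conj_A i ^ i \<in> R" if "i \<in> {1..<p}" for i using that by (intro Zz_power Zz_conj_A)
qed (auto intro!: conj_A_power_dvd_G Zz_power Zz_G simp del: One_nat_def)

text \<open>Comaximal divisors of \<open>l ^ p\<close> have their product among its divisors. This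
  bounds the norm only from above; smaller powers of \<open>l\<close> are excluded with the help of
  \<open>D\<close>.\<close>

lemma cnorm_A_dvd: "\<exists>y\<in>R. of_nat l ^ p = cnorm A * y"
  unfolding prod_inverse_conjugates[OF A_int, symmetric]
  by (rule comaximal_prod_divides)
     (auto intro!: conj_A_comaximal of_nat_l_dvd Zz_power Zz_of_nat Zz_conj_A simp del: One_nat_def)

lemma A_not_unit: "cnorm A \<noteq> 1" "cnorm A \<noteq> - 1"
proof -
  obtain y where y: "y \<in> R" "cnorm A = A * y" using dvd_cnorm[OF A_int] by blast
  have A: "A * z \<in> q" if "z \<in> R" for z
  proof -
    have "A * z \<in> principal R A" using that by (auto simp: principal_def)
    then show ?thesis using A_gen ideal_pow_subset_q[OF p_pos] by auto
  qed
  show "cnorm A \<noteq> 1" using A[OF y(1)] y(2) one_notin_q by auto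
  show "cnorm A \<noteq> - 1" using A[OF Zz_uminus[OF y(1)]] y(2) one_notin_q by auto
qed

text \<open>The norm is \<open>\<plusminus>l ^ s\<close> with \<open>s \<le> p\<close>, and \<open>2 * s\<close> is divisible by \<open>p\<close> because \<open>A * cnj A\<close> is a
  \<open>p\<close>-th power.\<close>
lemma cnorm_A:
  assumes D: "D \<in> R" and AD: "A * cnj A = D ^ p"
  shows "cnorm A = of_nat l ^ p"
proof -
  obtain n where n: "cnorm A = of_int n" using cnorm_is_int[OF A_int] by blast
  obtain d where d: "cnorm D = of_int d" using cnorm_is_int[OF D] by blast
  obtain y where y: "y \<in> R" "of_nat l ^ p = cnorm A * y" using cnorm_A_dvd by blast
  have "of_int (int l ^ p) = of_int n * y" using y n by simp
  then have "n dvd int l ^ p" using y(1) by (intro int_dvd_of_Zz)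
  then obtain s where s: "s \<le> p" "\<bar>n\<bar> = int l ^ s"
    using divides_primepow[of "int l" n p] l_prime by auto
  have "cnorm A * cnorm A = cnorm D ^ p"
    using cnorm_mult[OF A_int Zz_cnj[OF A_int]] cnorm_cnj[OF A_int] cnorm_power[OF D] AD by simp
  then have "of_int (n * n) = (of_int (d ^ p) :: complex)" using n d by simp
  then have "n * n = d ^ p" by (simp only: of_int_eq_iff)
  then have "\<bar>n * n\<bar> = \<bar>d ^ p\<bar>" by simp
  then have "\<bar>n\<bar> * \<bar>n\<bar> = \<bar>d\<bar> ^ p" by (simp only: power_abs abs_mult)
  then have "int l ^ (2 * s) = \<bar>d\<bar> ^ p" using s by (simp add: power_mult power2_eq_square power_mult_distrib mult_2 power_add)
  then have "multiplicity (int l) (int l ^ (2 * s)) = multiplicity (int l) (\<bar>d\<bar> ^ p)" by simp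
  moreover have "d \<noteq> 0" using \<open>int l ^ (2 * s) = \<bar>d\<bar> ^ p\<close> l_pos p_pos by (auto simp: power_0_left)
  ultimately have "2 * s = p * multiplicity (int l) \<bar>d\<bar>"
    using l_prime by (simp add: prime_elem_multiplicity_power_distrib)
  then have "p dvd 2 * s" by simp
  then have "p dvd s" using p_prime p_odd by (simp add: prime_dvd_mult_iff)
    (metis dvd_imp_le less_le_not_le p_gt_2 pos2)
  moreover have "s \<noteq> 0"
  proof
    assume "s = 0"
    then have "n = 1 \<or> n = - 1" using s(2) by auto
    then show False using A_not_unit n by auto
  qed
  ultimately have "s = p" using s(1) by (auto dest: dvd_imp_le)
  \<comment> \<open>The sign: the \<open>p\<close>-th power of the norm is the squared absolute
    value of \<open>stick A\<close>, and \<open>p\<close> is odd.\<close>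
  have "0 \<le> Re (cnorm A ^ p)"
    unfolding stick_mult_cnj[OF A_int, symmetric] by (simp add: complex_norm_square[symmetric])
  then have "0 \<le> n ^ p" unfolding n by (simp flip: of_int_power)
  then have "0 \<le> n" using p_odd by (metis zero_le_power_eq)
  then have "n = int l ^ p" using s \<open>s = p\<close> by simp
  then show ?thesis using n by simp
qed

end

section \<open>The quotient unit and the final congruence\<close>

theorem mainTheorem9:
  fixes p v m :: nat and \<Gamma> :: "complex set set set" and q :: "complex set"
    and A \<alpha> D :: complex
  assumes p_prime: "prime p" and p_odd: "odd p"
    and v_root: "residue_primroot p v"
    and irregular: "p dvd class_number (Zz p)"
    and plus_part: "\<not> p dvd class_number (Zplus p)"
    and m_ge: "1 \<le> m" and m_le: "2 * m \<le> p - 3"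
    and Gamma_sub: "subgroup \<Gamma> (class_group (Zz p))"
    and Gamma_Cp: "\<Gamma> \<subseteq> sylow_part (Zz p) p"
    and Gamma_card: "card \<Gamma> = p"
    and Gamma_ann: "\<forall>c\<in>\<Gamma>. sig_class p v c = c [^]\<^bsub>class_group (Zz p)\<^esub> vpow p v (2 * m + 1)"
    and q_prime: "prime_ideal (Zz p) q"
    and q_nonprinc: "\<not> is_principal (Zz p) q"
    and q_deg1: "prime (ideal_norm (Zz p) q)"
    and q_class: "ideal_class (Zz p) q \<in> \<Gamma>"
    and A_int: "A \<in> Zz p"
    and A_gen: "principal (Zz p) A = ideal_pow (Zz p) q p"
    and \<alpha>_K: "\<alpha> \<in> Kp p"
    and A_sig: "sig p v A = A ^ vpow p v (2 * m + 1) * \<alpha> ^ p"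
    and A_cong: "exact_pi p (2 * m + 1) (A - 1)"
    and D_plus: "D \<in> Zplus p"
    and A_norm: "A * cnj A = D ^ p"
  shows "cong_pi p (2 * (p - 1)) (Psig p v A) 1"
proof -
  interpret Q: degree_one_prime p q
    by unfold_locales (fact p_prime p_odd q_prime q_deg1)+
  obtain z where z: "z \<in> Zz p" "A - 1 = lam p ^ (2 * m + 1) * z"
    using A_cong by (auto simp: exact_pi_def cong_pi_def)
  \<comment> \<open>Two factors \<open>lam p\<close> are split off: this precision separates
    \<open>q\<close> from the prime above \<open>p\<close> and later determines the unit.\<close>
  have "2 * m + 1 = 2 + (2 * m - 1)" using m_ge by simp
  then have "A - 1 = (lam p)\<^sup>2 * (lam p ^ (2 * m - 1) * z)"
    using z(2) by (simp only: power_add mult.assoc)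
  moreover define a where "a = lam p ^ (2 * m - 1) * z"
  ultimately have A1: "A - 1 = (lam p)\<^sup>2 * a" by simp
  have aR: "a \<in> Zz p" unfolding a_def using z(1) by (intro Q.Zz_intros)
  have "A * 1 \<in> principal (Zz p) A" using Q.Zz_1 unfolding principal_def by blast
  then have "A \<in> q" using A_gen Q.ideal_pow_subset_q[OF Q.p_pos] by auto
  \<comment> \<open>Otherwise \<open>A - 1\<close> would lie in \<open>q\<close> together with
    \<open>A\<close>.\<close>
  have "lam p \<notin> q"
  proof
    assume "lam p \<in> q"
    then have "(lam p * a) * lam p \<in> q" using aR by (intro Q.q_mult Q.Zz_intros)
    then have "A - 1 \<in> q" using A1 by (simp add: power2_eq_square mult_ac)
    then show False using Q.q_diff[OF \<open>A \<in> q\<close>] Q.one_notin_q by fastforce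
  qed
  moreover obtain r :: nat where "zeta p - of_nat r \<in> q" using Q.ex_int_residue[OF Q.Zz_zeta] by blast
  ultimately interpret Q: pth_power_generator p q r A
    using A_int A_gen by unfold_locales
  have D: "D \<in> Zz p" using D_plus by (simp add: Zplus_def)
  obtain \<epsilon> where \<epsilon>: "\<epsilon> \<in> Zz p" "Q.G ^ p = Q.stick A * \<epsilon>" using Q.stick_dvd_G by blast
  have GG: "Q.G ^ p * cnj (Q.G ^ p) = of_nat (ideal_norm (Zz p) q) ^ (p * p)"
    using Q.G_mult_cnj by (metis complex_cnj_power power_mult_distrib power_mult)
  have SS: "Q.stick A * cnj (Q.stick A) = of_nat (ideal_norm (Zz p) q) ^ (p * p)"
    using Q.stick_mult_cnj[OF A_int] Q.cnorm_A[OF D A_norm] by (simp add: power_mult)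
  \<comment> \<open>Both sides have squared absolute value \<open>l ^ (p * p)\<close>, so
    \<open>\<epsilon>\<close> has absolute value 1.\<close>
  have "Q.stick A * cnj (Q.stick A) * (\<epsilon> * cnj \<epsilon>) = Q.stick A * cnj (Q.stick A)"
    unfolding SS GG[symmetric] unfolding \<epsilon>(2) using SS GG \<epsilon>(2) by (metis complex_cnj_mult mult.assoc mult.left_commute)
  moreover have "Q.stick A * cnj (Q.stick A) \<noteq> 0" unfolding SS using Q.l_pos by simp
  ultimately have unit: "\<epsilon> * cnj \<epsilon> = 1" by simp
  obtain y where y: "y \<in> Zz p" "Q.stick A = 1 + (lam p)\<^sup>2 * y"
    using Q.stick_cong_1[OF A_int aR A1] by blast
  obtain h where h: "h \<in> Zz p" "Q.G ^ p = - 1 + of_nat (p\<^sup>2) * h" using Q.G_pow_p_cong by blast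
  obtain w where w: "w \<in> Zz p" "of_nat p = (lam p)\<^sup>2 * w"
  proof -
    have "2 \<le> p - 1" using Q.p_gt_2 by simp
    then show ?thesis using Q.p_lam_pow that by blast
  qed
  \<comment> \<open>Modulo the square of \<open>lam p\<close> the equation
    \<open>G ^ p = stick A * \<epsilon>\<close> reads \<open>- 1 = \<epsilon>\<close>, so the
    Kronecker argument is applied to \<open>- \<epsilon>\<close>.\<close>
  have "- \<epsilon> - 1 = (lam p)\<^sup>2 * (y * \<epsilon> - of_nat p * w * h)"
  proof -
    have "- 1 + of_nat (p\<^sup>2) * h = (1 + (lam p)\<^sup>2 * y) * \<epsilon>" using h(2) \<epsilon>(2) y(2) by simp
    moreover have "of_nat (p\<^sup>2) = (lam p)\<^sup>2 * (of_nat p * w)"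
      using w(2) by (metis mult.left_commute of_nat_mult power2_eq_square)
    ultimately show ?thesis by (simp add: algebra_simps)
  qed
  moreover have "- \<epsilon> \<in> Zz p" using \<epsilon>(1) by (rule Q.Zz_uminus)
  moreover have "y * \<epsilon> - of_nat p * w * h \<in> Zz p"
    using \<epsilon>(1) y(1) w(1) h(1) by (intro Q.Zz_intros)
  moreover have "- \<epsilon> * cnj (- \<epsilon>) = 1" using unit by simp
  ultimately have "- \<epsilon> = 1" using Q.unit_eq_1 by blast
  \<comment> \<open>The equality is now exact, so the congruence for \<open>G ^ p\<close> modulo the
    square of \<open>p\<close> passes to \<open>stick A\<close> undiminished.\<close>
  then have "Q.stick A = - (Q.G ^ p)" using \<epsilon>(2) by (metis mult_minus_right mult.right_neutral)
  then have "Q.stick A - 1 = of_nat (p\<^sup>2) * (- h)" using h(2) by simp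
  then have "cong_pi p (2 * (p - 1)) (Q.stick A) 1"
    using h(1) by (intro Q.cong_pi_of_p_square[of "- h"] Q.Zz_uminus)
  then show ?thesis using Q.Psig_eq_stick[OF v_root A_int] by simp
qed

end
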